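(* Let $S$ be a densely defined operator in a complex Hilbert space $\mathcal{H}$. Suppose that there are a family $\{\mathcal{H}_\omega\}_{\omega \in \Omega}$ of closed linear subspaces of $\mathcal{H}$ and an upward directed family $\{\mathcal{X}_\omega\}_{\omega \in \Omega}$ of subsets of $\mathcal{H}$ such that (i) $\mathcal{X}_\omega \subseteq \mathcal{D}^\infty(S)$ and $S^n(\mathcal{X}_\omega) \subseteq \mathcal{H}_\omega$ for all $n\in \mathbb{Z}_+$ and $\omega \in \Omega$, (ii) $\mathcal{F}_\omega:=\mathrm{lin} \bigcup_{n=0}^\infty S^n(\mathcal{X}_\omega)$ is dense in $\mathcal{H}_\omega$ for every $\omega \in \Omega$, (iii) $S|_{\mathcal{F}_\omega}$ is a subnormal operator in $\mathcal{H}_\omega$ for every $\omega \in \Omega$, (iv) $\mathcal{F}:=\mathrm{lin} \bigcup_{n=0}^\infty S^n\big(\bigcup_{\omega \in \Omega} \mathcal{X}_\omega\big)$ is a core of $S$. Then $S$ is subnormal.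
   Context: All operators are linear and possibly unbounded; $\mathcal{D}(A)$ is the domain of $A$, $\mathcal{D}^\infty(A)=\bigcap_{n=0}^\infty\mathcal{D}(A^n)$, and $\mathbb{Z}_+=\{0,1,2,\ldots\}$. $\mathrm{lin}$ denotes linear span. A family $\{\mathcal{X}_\omega\}_{\omega\in\Omega}$ of sets is upward directed if for all $\omega_1,\omega_2\in\Omega$ there is $\omega\in\Omega$ with $\mathcal{X}_{\omega_1}\cup\mathcal{X}_{\omega_2}\subseteq\mathcal{X}_\omega$. A linear subspace $\mathcal{E}$ of $\mathcal{D}(A)$ is a core of $A$ if the graph of $A$ is contained in the closure of the graph of the restriction $A|_{\mathcal{E}}$ of $A$ to $\mathcal{E}$. A densely defined operator $S$ in a complex Hilbert space $\mathcal{H}$ is subnormal if there exist a complex Hilbert space $\mathcal{K}\supseteq\mathcal{H}$ (isometric embedding) and a (possibly unbounded) normal operator $N$ in $\mathcal{K}$ such that $\mathcal{D}(S)\subseteq\mathcal{D}(N)$ and $Sh=Nh$ for all $h\in\mathcal{D}(S)$. *)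

theory Defs
  imports "HOL-Analysis.Analysis"
begin

section \<open>Complex Hilbert spaces\<close>

class complex_vector = real_vector +
  fixes scaleC :: "complex \<Rightarrow> 'a \<Rightarrow> 'a"  (infixr "*\<^sub>C" 75)
  assumes scaleC_add_right: "a *\<^sub>C (x + y) = a *\<^sub>C x + a *\<^sub>C y"
    and scaleC_add_left: "(a + b) *\<^sub>C x = a *\<^sub>C x + b *\<^sub>C x"
    and scaleC_scaleC: "a *\<^sub>C (b *\<^sub>C x) = (a * b) *\<^sub>C x"
    and scaleC_one: "1 *\<^sub>C x = x"
    and scaleR_eq_scaleC: "r *\<^sub>R x = complex_of_real r *\<^sub>C x"

global_interpretation complex_vector:
  vector_space "scaleC :: complex \<Rightarrow> 'a \<Rightarrow> 'a::complex_vector"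
  defines csubspace = complex_vector.subspace
    and cspan = complex_vector.span
  by unfold_locales (simp_all add: scaleC_add_right scaleC_add_left scaleC_scaleC scaleC_one)

text \<open>
  The complex inner product is linear in its first argument.  Positive definiteness and the
  norm are inherited from \<^class>\<open>real_inner\<close>: Hermitian symmetry makes \<open>cinner x x\<close> real, hence
  equal to \<open>inner x x\<close>, and so \<open>norm x = sqrt (Re (cinner x x))\<close>.
\<close>

class complex_inner = complex_vector + real_inner +
  fixes cinner :: "'a \<Rightarrow> 'a \<Rightarrow> complex"
  assumes cinner_commute: "cinner x y = cnj (cinner y x)"
    and cinner_add_left: "cinner (x + y) z = cinner x z + cinner y z"
    and cinner_scaleC_left: "cinner (c *\<^sub>C x) y = c * cinner x y"
    and inner_eq_Re_cinner: "inner x y = Re (cinner x y)"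

class chilbert_space = complex_inner + complete_space

lemma cinner_self: "cinner x x = complex_of_real ((norm x)\<^sup>2)" for x :: "'a::complex_inner"
proof -
  have "Im (cinner x x) = 0"
    using cinner_commute[of x x] by (metis complex_cnj_cancel_iff cnj.simps(2) eq_neg_iff_add_eq_0
        add_self_div_2 double_zero)
  then show ?thesis
    by (simp add: complex_eq_iff power2_norm_eq_inner inner_eq_Re_cinner)
qed

definition closed_csubspace :: "'a::complex_inner set \<Rightarrow> bool" where
  "closed_csubspace H \<longleftrightarrow> csubspace H \<and> closed H"

definition dense_in :: "'a::topological_space set \<Rightarrow> 'a set \<Rightarrow> bool" where
  "dense_in E H \<longleftrightarrow> E \<subseteq> H \<and> H \<subseteq> closure E"


section \<open>The Hilbert space of square-summable families\<close>

typedef 'i ell2 = "{f :: 'i \<Rightarrow> complex. (\<lambda>i. (cmod (f i))\<^sup>2) summable_on UNIV}"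
  by (rule exI[of _ "\<lambda>_. 0"]) simp

setup_lifting type_definition_ell2

lemma ell2_add_aux:
  fixes f g :: "'i \<Rightarrow> complex"
  assumes "(\<lambda>i. (cmod (f i))\<^sup>2) summable_on UNIV" "(\<lambda>i. (cmod (g i))\<^sup>2) summable_on UNIV"
  shows "(\<lambda>i. (cmod (f i + g i))\<^sup>2) summable_on UNIV"
proof (rule summable_on_comparison_test)
  show "(\<lambda>i. 2 * (cmod (f i))\<^sup>2 + 2 * (cmod (g i))\<^sup>2) summable_on UNIV"
    using assms by (intro summable_on_add summable_on_cmult_right)
  fix i
  have "(cmod (f i + g i))\<^sup>2 \<le> (cmod (f i) + cmod (g i))\<^sup>2"
    by (simp add: norm_triangle_ineq power_mono)
  also have "\<dots> \<le> 2 * (cmod (f i))\<^sup>2 + 2 * (cmod (g i))\<^sup>2"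
    using sum_squares_bound[of "cmod (f i)" "cmod (g i)"] by (simp add: power2_sum)
  finally show "(cmod (f i + g i))\<^sup>2 \<le> 2 * (cmod (f i))\<^sup>2 + 2 * (cmod (g i))\<^sup>2" .
qed simp

lemma ell2_scale_aux:
  fixes f :: "'i \<Rightarrow> complex"
  assumes "(\<lambda>i. (cmod (f i))\<^sup>2) summable_on UNIV"
  shows "(\<lambda>i. (cmod (c * f i))\<^sup>2) summable_on UNIV"
  using summable_on_cmult_right[OF assms, of "(cmod c)\<^sup>2"]
  by (simp add: norm_mult power_mult_distrib)

lemma ell2_mult_aux:
  fixes f g :: "'i \<Rightarrow> complex"
  assumes "(\<lambda>i. (cmod (f i))\<^sup>2) summable_on UNIV" "(\<lambda>i. (cmod (g i))\<^sup>2) summable_on UNIV"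
  shows "(\<lambda>i. f i * cnj (g i)) summable_on UNIV"
proof (rule abs_summable_summable, rule summable_on_comparison_test)
  show "(\<lambda>i. (cmod (f i))\<^sup>2 + (cmod (g i))\<^sup>2) summable_on UNIV"
    using assms by (intro summable_on_add)
  fix i
  have "0 \<le> (cmod (f i))\<^sup>2 + (cmod (g i))\<^sup>2" "2 * cmod (f i) * cmod (g i) \<le> (cmod (f i))\<^sup>2 + (cmod (g i))\<^sup>2"
    using sum_squares_bound[of "cmod (f i)" "cmod (g i)"] by simp_all
  then show "cmod (f i * cnj (g i)) \<le> (cmod (f i))\<^sup>2 + (cmod (g i))\<^sup>2"
    unfolding norm_mult complex_mod_cnj by linarith
qed simp

lemma ell2_self_aux:
  fixes f :: "'i \<Rightarrow> complex"
  assumes "(\<lambda>i. (cmod (f i))\<^sup>2) summable_on UNIV"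
  shows "Re (\<Sum>\<^sub>\<infinity>i. f i * cnj (f i)) = (\<Sum>\<^sub>\<infinity>i. (cmod (f i))\<^sup>2)"
proof -
  have "Re (\<Sum>\<^sub>\<infinity>i. f i * cnj (f i)) = (\<Sum>\<^sub>\<infinity>i. Re (f i * cnj (f i)))"
    by (rule infsum_Re[symmetric]) (rule ell2_mult_aux[OF assms assms])
  also have "\<dots> = (\<Sum>\<^sub>\<infinity>i. (cmod (f i))\<^sup>2)"
    by (simp only: complex_norm_square[symmetric] Re_complex_of_real)
  finally show ?thesis .
qed

instantiation ell2 :: (type) complex_inner
begin

lift_definition zero_ell2 :: "'a ell2" is "\<lambda>_. 0" by simp

lift_definition plus_ell2 :: "'a ell2 \<Rightarrow> 'a ell2 \<Rightarrow> 'a ell2" is "\<lambda>f g i. f i + g i"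
  by (rule ell2_add_aux)

lift_definition uminus_ell2 :: "'a ell2 \<Rightarrow> 'a ell2" is "\<lambda>f i. - f i" by simp

lift_definition minus_ell2 :: "'a ell2 \<Rightarrow> 'a ell2 \<Rightarrow> 'a ell2" is "\<lambda>f g i. f i - g i"
  subgoal for f g using ell2_add_aux[of f "\<lambda>i. - g i"] by simp
  done

lift_definition scaleC_ell2 :: "complex \<Rightarrow> 'a ell2 \<Rightarrow> 'a ell2" is "\<lambda>c f i. c * f i"
  by (rule ell2_scale_aux)

definition scaleR_ell2 :: "real \<Rightarrow> 'a ell2 \<Rightarrow> 'a ell2" where
  "scaleR_ell2 r x = complex_of_real r *\<^sub>C x"

lift_definition cinner_ell2 :: "'a ell2 \<Rightarrow> 'a ell2 \<Rightarrow> complex" is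
  "\<lambda>f g. \<Sum>\<^sub>\<infinity>i. f i * cnj (g i)" .

definition inner_ell2 :: "'a ell2 \<Rightarrow> 'a ell2 \<Rightarrow> real" where
  "inner_ell2 x y = Re (cinner x y)"

definition norm_ell2 :: "'a ell2 \<Rightarrow> real" where
  "norm_ell2 x = sqrt (inner x x)"

definition sgn_ell2 :: "'a ell2 \<Rightarrow> 'a ell2" where
  "sgn_ell2 x = inverse (norm x) *\<^sub>R x"

definition dist_ell2 :: "'a ell2 \<Rightarrow> 'a ell2 \<Rightarrow> real" where
  "dist_ell2 x y = norm (x - y)"

definition uniformity_ell2 :: "('a ell2 \<times> 'a ell2) filter" where
  "uniformity_ell2 = (INF e\<in>{0<..}. principal {(x, y). dist x y < e})"

definition open_ell2 :: "'a ell2 set \<Rightarrow> bool" where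
  "open_ell2 U \<longleftrightarrow> (\<forall>x\<in>U. \<forall>\<^sub>F (x', y) in uniformity. x' = x \<longrightarrow> y \<in> U)"

instance
proof
  fix x y z :: "'a ell2" and a b :: complex and r s :: real
  show "x + y + z = x + (y + z)" "x + y = y + x" "0 + x = x" "- x + x = 0" "x - y = x + - y"
    by (transfer; simp add: fun_eq_iff)+
  show sC: "a *\<^sub>C (x + y) = a *\<^sub>C x + a *\<^sub>C y" "(a + b) *\<^sub>C x = a *\<^sub>C x + b *\<^sub>C x"
    "a *\<^sub>C (b *\<^sub>C x) = (a * b) *\<^sub>C x" "1 *\<^sub>C x = x"
    by (transfer; simp add: fun_eq_iff algebra_simps)+
  show "r *\<^sub>R x = complex_of_real r *\<^sub>C x" by (simp add: scaleR_ell2_def)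
  show "r *\<^sub>R (x + y) = r *\<^sub>R x + r *\<^sub>R y" "(r + s) *\<^sub>R x = r *\<^sub>R x + s *\<^sub>R x"
    "r *\<^sub>R (s *\<^sub>R x) = (r * s) *\<^sub>R x" "1 *\<^sub>R x = x"
    unfolding scaleR_ell2_def by (transfer; simp add: fun_eq_iff algebra_simps)+
  show cc: "cinner x y = cnj (cinner y x)" for x y :: "'a ell2"
    by transfer (simp add: mult.commute flip: infsum_cnj)
  show ca: "cinner (x + y) z = cinner x z + cinner y z" for x y z :: "'a ell2"
    by transfer (simp add: distrib_right infsum_add ell2_mult_aux)
  show cs: "cinner (a *\<^sub>C x) y = a * cinner x y" for a and x y :: "'a ell2"
    by transfer (simp add: mult.assoc infsum_cmult_right')
  show "inner x y = Re (cinner x y)" by (simp add: inner_ell2_def)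
  show "inner x y = inner y x" unfolding inner_ell2_def by (subst cc) simp
  show "inner (x + y) z = inner x z + inner y z" by (simp add: inner_ell2_def ca)
  show "inner (r *\<^sub>R x) y = r * inner x y" by (simp add: inner_ell2_def scaleR_ell2_def cs)
  have xx: "inner x x = (\<Sum>\<^sub>\<infinity>i. (cmod (Rep_ell2 x i))\<^sup>2)"
    using ell2_self_aux[of "Rep_ell2 x"] Rep_ell2[of x]
    by (simp add: inner_ell2_def cinner_ell2.rep_eq)
  show "0 \<le> inner x x" unfolding xx by (simp add: infsum_nonneg)
  show "inner x x = 0 \<longleftrightarrow> x = 0"
  proof
    assume "inner x x = 0"
    then have "(cmod (Rep_ell2 x i))\<^sup>2 = 0" for i
      using nonneg_infsum_le_0D[of "\<lambda>i. (cmod (Rep_ell2 x i))\<^sup>2" UNIV i] Rep_ell2[of x]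
      by (simp add: xx)
    then have "Rep_ell2 x = Rep_ell2 0" by (simp add: fun_eq_iff zero_ell2.rep_eq)
    then show "x = 0" by (simp add: Rep_ell2_inject)
  next
    assume "x = 0"
    then show "inner x x = 0" unfolding xx by (simp add: zero_ell2.rep_eq)
  qed
  show "norm x = sqrt (inner x x)" by (rule norm_ell2_def)
  show "sgn x = inverse (norm x) *\<^sub>R x" by (rule sgn_ell2_def)
  show "dist x y = norm (x - y)" by (rule dist_ell2_def)
  show "uniformity = (INF e\<in>{0<..}. principal {(x, y :: 'a ell2). dist x y < e})"
    by (rule uniformity_ell2_def)
  show "open U \<longleftrightarrow> (\<forall>x\<in>U. \<forall>\<^sub>F (x', y) in uniformity. x' = x \<longrightarrow> y \<in> U)" for U :: "'a ell2 set"
    by (rule open_ell2_def)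
qed

end

lemma norm_ell2_sq: "(norm x)\<^sup>2 = (\<Sum>\<^sub>\<infinity>i. (cmod (Rep_ell2 x i))\<^sup>2)"
  using ell2_self_aux[of "Rep_ell2 x"] Rep_ell2[of x]
  by (simp add: power2_norm_eq_inner inner_ell2_def cinner_ell2.rep_eq)

lemma summable_ell2: "(\<lambda>i. (cmod (Rep_ell2 x i))\<^sup>2) summable_on UNIV"
  using Rep_ell2[of x] by simp

lemma sum_le_norm_ell2:
  assumes "finite F"
  shows "(\<Sum>i\<in>F. (cmod (Rep_ell2 x i))\<^sup>2) \<le> (norm x)\<^sup>2"
  unfolding norm_ell2_sq using assms summable_ell2 by (intro finite_sum_le_infsum) auto

instance ell2 :: (type) chilbert_space
proof
  fix X :: "nat \<Rightarrow> 'a ell2"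
  assume X: "Cauchy X"
  have coord: "cmod (Rep_ell2 (X m) i - Rep_ell2 (X n) i) \<le> dist (X m) (X n)" for m n i
  proof -
    have "(cmod (Rep_ell2 (X m - X n) i))\<^sup>2 \<le> (norm (X m - X n))\<^sup>2"
      using sum_le_norm_ell2[of "{i}"] by simp
    then show ?thesis
      by (simp add: dist_norm minus_ell2.rep_eq)
  qed
  have "Cauchy (\<lambda>n. Rep_ell2 (X n) i)" for i
    by (rule metric_CauchyI) (metis X metric_CauchyD coord dist_norm order_le_less_trans)
  then have "\<exists>l. (\<lambda>n. Rep_ell2 (X n) i) \<longlonglongrightarrow> l" for i
    by (simp add: Cauchy_convergent_iff convergent_def)
  then obtain L where L: "\<And>i. (\<lambda>n. Rep_ell2 (X n) i) \<longlonglongrightarrow> L i" by metis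
  have bound: "\<exists>N. \<forall>n\<ge>N. \<forall>F. finite F \<longrightarrow> (\<Sum>i\<in>F. (cmod (L i - Rep_ell2 (X n) i))\<^sup>2) \<le> e\<^sup>2"
    if e: "e > 0" for e
  proof -
    obtain N where N: "\<And>m n. m \<ge> N \<Longrightarrow> n \<ge> N \<Longrightarrow> dist (X m) (X n) < e"
      using metric_CauchyD[OF X e] by blast
    have "(\<Sum>i\<in>F. (cmod (L i - Rep_ell2 (X n) i))\<^sup>2) \<le> e\<^sup>2" if "n \<ge> N" "finite F" for n F
    proof (rule tendsto_upperbound)
      show "(\<lambda>m. \<Sum>i\<in>F. (cmod (Rep_ell2 (X m) i - Rep_ell2 (X n) i))\<^sup>2)
              \<longlonglongrightarrow> (\<Sum>i\<in>F. (cmod (L i - Rep_ell2 (X n) i))\<^sup>2)"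
        by (intro tendsto_intros L)
      show "\<forall>\<^sub>F m in sequentially. (\<Sum>i\<in>F. (cmod (Rep_ell2 (X m) i - Rep_ell2 (X n) i))\<^sup>2) \<le> e\<^sup>2"
      proof (rule eventually_sequentiallyI)
        fix m assume "m \<ge> N"
        have "(\<Sum>i\<in>F. (cmod (Rep_ell2 (X m - X n) i))\<^sup>2) \<le> (norm (X m - X n))\<^sup>2"
          by (rule sum_le_norm_ell2) fact
        also have "\<dots> \<le> e\<^sup>2"
          using N[OF \<open>m \<ge> N\<close> \<open>n \<ge> N\<close>] by (intro power_mono) (simp_all add: dist_norm)
        finally show "(\<Sum>i\<in>F. (cmod (Rep_ell2 (X m) i - Rep_ell2 (X n) i))\<^sup>2) \<le> e\<^sup>2"
          by (simp add: minus_ell2.rep_eq)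
      qed
    qed simp
    then show ?thesis by blast
  qed
  have diff: "(\<lambda>i. (cmod (L i - Rep_ell2 (X n) i))\<^sup>2) summable_on UNIV"
    if "\<forall>F. finite F \<longrightarrow> (\<Sum>i\<in>F. (cmod (L i - Rep_ell2 (X n) i))\<^sup>2) \<le> e\<^sup>2" for n e
    using that by (intro nonneg_bdd_above_summable_on bdd_aboveI2[where M="e\<^sup>2"]) auto
  obtain N where "\<forall>F. finite F \<longrightarrow> (\<Sum>i\<in>F. (cmod (L i - Rep_ell2 (X N) i))\<^sup>2) \<le> 1\<^sup>2"
    using bound[of 1] by auto
  from ell2_add_aux[OF diff[OF this] summable_ell2[of "X N"]]
  have "(\<lambda>i. (cmod (L i))\<^sup>2) summable_on UNIV" by simp
  then have RL: "Rep_ell2 (Abs_ell2 L) = L" by (simp add: Abs_ell2_inverse)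
  have "X \<longlonglongrightarrow> Abs_ell2 L"
  proof (rule metric_LIMSEQ_I)
    fix r :: real assume "r > 0"
    then obtain N where N: "\<And>n F. n \<ge> N \<Longrightarrow> finite F \<Longrightarrow>
        (\<Sum>i\<in>F. (cmod (L i - Rep_ell2 (X n) i))\<^sup>2) \<le> (r/2)\<^sup>2"
      using bound[of "r/2"] by auto
    have "dist (X n) (Abs_ell2 L) < r" if "n \<ge> N" for n
    proof -
      have "(norm (Abs_ell2 L - X n))\<^sup>2 \<le> (r/2)\<^sup>2"
        unfolding norm_ell2_sq minus_ell2.rep_eq RL using N that
        by (intro infsum_le_finite_sums diff[where e="r/2"]) auto
      then have "norm (Abs_ell2 L - X n) \<le> r/2"
        using \<open>r > 0\<close> by (simp add: power2_le_iff_abs_le)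
      then show ?thesis using \<open>r > 0\<close> by (simp add: dist_norm norm_minus_commute)
    qed
    then show "\<exists>N. \<forall>n\<ge>N. dist (X n) (Abs_ell2 L) < r" by blast
  qed
  then show "convergent X" by (rule convergentI)
qed


section \<open>Unbounded operators\<close>

text \<open>
  An operator is identified with its graph.  Hence the domain of \<open>T\<close> is \<^term>\<open>Domain T\<close>, \<open>A \<subseteq> B\<close>
  means that \<open>B\<close> extends \<open>A\<close>, the product \<open>AB\<close> (apply \<open>B\<close> first, on its maximal domain) is the
  relational composition \<open>B O A\<close>, the power \<open>T\<^sup>n\<close> is \<open>T ^^ n\<close> (with \<open>T ^^ 0 = Id\<close>), and
  the image \<open>T\<^sup>n(X)\<close> is \<open>(T ^^ n) `` X\<close>.
\<close>

type_synonym 'a operator = "('a \<times> 'a) set"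

definition operator_in :: "'a::complex_inner set \<Rightarrow> 'a operator \<Rightarrow> bool" where
  "operator_in H T \<longleftrightarrow> T \<subseteq> H \<times> H \<and> single_valued T \<and> (0, 0) \<in> T \<and>
     (\<forall>x y x' y'. (x, y) \<in> T \<longrightarrow> (x', y') \<in> T \<longrightarrow> (x + x', y + y') \<in> T) \<and>
     (\<forall>c x y. (x, y) \<in> T \<longrightarrow> (c *\<^sub>C x, c *\<^sub>C y) \<in> T)"

definition densely_defined_in :: "'a::complex_inner set \<Rightarrow> 'a operator \<Rightarrow> bool" where
  "densely_defined_in H T \<longleftrightarrow> operator_in H T \<and> dense_in (Domain T) H"

definition op_restrict :: "'a operator \<Rightarrow> 'a set \<Rightarrow> 'a operator" where
  "op_restrict T E = {(x, y) \<in> T. x \<in> E}"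

definition D_infinity :: "'a operator \<Rightarrow> 'a set" where
  "D_infinity T = (\<Inter>n. Domain (T ^^ n))"

definition is_core :: "'a::complex_inner set \<Rightarrow> 'a operator \<Rightarrow> bool" where
  "is_core E T \<longleftrightarrow> csubspace E \<and> E \<subseteq> Domain T \<and> T \<subseteq> closure (op_restrict T E)"

definition orbit_span :: "'a::complex_vector operator \<Rightarrow> 'a set \<Rightarrow> 'a set" where
  "orbit_span T X = cspan (\<Union>n. (T ^^ n) `` X)"

definition adjoint_in :: "'a::complex_inner set \<Rightarrow> 'a operator \<Rightarrow> 'a operator" where
  "adjoint_in K T = {(u, v). u \<in> K \<and> v \<in> K \<and> (\<forall>(x, y)\<in>T. cinner y u = cinner x v)}"

text \<open>Normality of \<open>N\<close> is \<open>N\<^sup>*N = NN\<^sup>*\<close> (with equality of domains) for densely defined closed \<open>N\<close>.\<close>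

definition normal_in :: "'a::complex_inner set \<Rightarrow> 'a operator \<Rightarrow> bool" where
  "normal_in K N \<longleftrightarrow> densely_defined_in K N \<and> closed N \<and>
     N O adjoint_in K N = adjoint_in K N O N"

definition isometric_embedding ::
  "'a::complex_inner set \<Rightarrow> 'b::complex_inner set \<Rightarrow> ('a \<Rightarrow> 'b) \<Rightarrow> bool" where
  "isometric_embedding H K V \<longleftrightarrow> V ` H \<subseteq> K \<and>
     (\<forall>x\<in>H. \<forall>y\<in>H. V (x + y) = V x + V y) \<and>
     (\<forall>c. \<forall>x\<in>H. V (c *\<^sub>C x) = c *\<^sub>C V x) \<and>
     (\<forall>x\<in>H. norm (V x) = norm x)"

text \<open>
  HOL cannot quantify existentially over types, so the type \<open>'k\<close> that hosts the Hilbert space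
  \<open>K\<close> of the normal extension is a parameter; \<open>K\<close> itself is an arbitrary closed subspace of it.
  In hypotheses \<open>'k\<close> should be an arbitrary type.  In conclusions about operators in spaces of
  type \<open>'a\<close> it should be big enough: a minimal normal extension is the closed linear span of the
  orbit of \<open>H\<close> under words in the bounded operators \<open>(I + N\<^sup>*N)\<^sup>-\<^sup>1\<close>, \<open>N(I + N\<^sup>*N)\<^sup>-\<^sup>1\<close> and the adjoint
  of the latter, hence is spanned by a family indexed by \<open>'a \<times> nat\<close>; so it embeds
  isometrically into \<open>('a \<times> nat) ell2\<close>, a fortiori into \<open>('a \<times> nat \<Rightarrow> complex) ell2\<close>.
\<close>

definition subnormal ::
  "'k::chilbert_space itself \<Rightarrow> 'a::chilbert_space set \<Rightarrow> 'a operator \<Rightarrow> bool" where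
  "subnormal _ H S \<longleftrightarrow> densely_defined_in H S \<and>
     (\<exists>(K :: 'k set) V N. closed_csubspace K \<and> isometric_embedding H K V \<and> normal_in K N \<and>
        (\<forall>(x, y)\<in>S. (V x, V y) \<in> N))"

definition upward_directed :: "'w set \<Rightarrow> ('w \<Rightarrow> 'a set) \<Rightarrow> bool" where
  "upward_directed \<Omega> X \<longleftrightarrow> (\<forall>\<omega>1\<in>\<Omega>. \<forall>\<omega>2\<in>\<Omega>. \<exists>\<omega>\<in>\<Omega>. X \<omega>1 \<union> X \<omega>2 \<subseteq> X \<omega>)"

end

theory Submission
  imports Defs
begin

text \<open>
  A normal operator \<open>N\<close> is encoded by three bounded operators, \<open>R = (I + N\<^sup>*N)\<^sup>-\<^sup>1\<close>, \<open>Z = NR\<close> and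
  \<open>Z\<^sup>* = N\<^sup>*R\<close>, which commute with \<open>R\<close> and satisfy \<open>Z\<^sup>*Z = ZZ\<^sup>* = R - R\<^sup>2\<close>.  If \<open>V\<close> embeds the space of
  an operator \<open>T\<close> isometrically so that \<open>N\<close> extends \<open>T\<close>, then \<open>T\<close> enters through bounded relations
  only: \<open>R V T f = Z V f\<close> and \<open>V f = R V f + Z\<^sup>* V T f\<close>.  So a normal extension amounts to the family
  of vectors \<open>\<psi>(f, w)\<close>, the word \<open>w\<close> in \<open>R\<close>, \<open>Z\<close>, \<open>Z\<^sup>*\<close> applied to \<open>V f\<close>, and all that matters about
  the family is expressed by its inner products.  Such a family is called a dilation of \<open>T\<close> below.

  This description passes to limits.  Each restriction of \<open>S\<close> to an orbit span has a dilation
  (\<open>normal_extension_imp_dilation\<close>), whose Gram kernel is bounded by a constant multiple of \<open>\<parallel>f\<parallel> \<parallel>g\<parallel>\<close>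
  because \<open>R\<close>, \<open>Z\<close> and \<open>Z\<^sup>*\<close> are contractions.  By compactness of products of discs these kernels
  have a cluster point along the directed family; it is positive definite, hence the Gram kernel
  of vectors in a space of square-summable families, and these vectors form a dilation of the
  restriction of \<open>S\<close> to the union of the orbit spans (\<open>dilation_limit\<close>).

  Conversely a dilation produces a normal extension on the closed span \<open>K\<close> of its vectors
  (\<open>dilation_imp_normal_extension\<close>).  The letters act on \<open>K\<close> as bounded operators, and the normal
  operator is \<open>R\<^sup>-\<^sup>1 Z\<close>.  What has to be excluded is that mass escapes to infinity in the limit, that
  is, that \<open>R\<close> acquires a kernel.  The relation \<open>V f = R V f + Z\<^sup>* V T f\<close> prevents it: a vector in the
  kernel of \<open>R\<close> is annihilated by \<open>Z\<close> and \<open>Z\<^sup>*\<close> too, so it is orthogonal to \<open>V f\<close> and to all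
  \<open>\<psi>(f, w)\<close>.  Finally, normal operators are closed, so the extension reaches from the core to the
  whole of \<open>S\<close>.
\<close>

section \<open>Complex inner products\<close>

lemma cinner_add_right: "cinner x (y + z) = cinner x y + cinner x z"
  by (subst (1 2 3) cinner_commute) (simp add: cinner_add_left)

lemma cinner_scaleC_right: "cinner x (c *\<^sub>C y) = cnj c * cinner x y"
  by (subst (1 2) cinner_commute) (simp add: cinner_scaleC_left)

lemma cinner_zero_left [simp]: "cinner 0 y = 0"
  using cinner_add_left[of 0 0 y] by simp

lemma cinner_zero_right [simp]: "cinner x 0 = 0"
  using cinner_add_right[of x 0 0] by simp

lemma cinner_minus_left: "cinner (- x) y = - cinner x y"
  using cinner_add_left[of x "- x" y] by (simp add: eq_neg_iff_add_eq_0 add.commute)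

lemma cinner_minus_right: "cinner x (- y) = - cinner x y"
  using cinner_add_right[of x y "- y"] by (simp add: eq_neg_iff_add_eq_0 add.commute)

lemma cinner_diff_left: "cinner (x - y) z = cinner x z - cinner y z"
  using cinner_add_left[of x "- y" z] by (simp add: cinner_minus_left)

lemma cinner_diff_right: "cinner x (y - z) = cinner x y - cinner x z"
  using cinner_add_right[of x y "- z"] by (simp add: cinner_minus_right)

lemma cinner_sum_left: "cinner (sum f A) y = (\<Sum>a\<in>A. cinner (f a) y)"
  by (induction A rule: infinite_finite_induct) (simp_all add: cinner_add_left)

lemma cinner_sum_right: "cinner x (sum f A) = (\<Sum>a\<in>A. cinner x (f a))"
  by (induction A rule: infinite_finite_induct) (simp_all add: cinner_add_right)

lemma cinner_self_eq_0: "cinner x x = 0 \<longleftrightarrow> x = 0"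
  by (simp add: cinner_self)

lemma norm_scaleC: "norm (c *\<^sub>C x) = cmod c * norm x" for x :: "'a::complex_inner"
proof -
  have "complex_of_real ((norm (c *\<^sub>C x))\<^sup>2) = (c * cnj c) * cinner x x"
    by (simp only: cinner_self[symmetric] cinner_scaleC_left cinner_scaleC_right mult_ac)
  also have "\<dots> = complex_of_real ((cmod c * norm x)\<^sup>2)"
    by (simp add: cinner_self complex_norm_square[symmetric] power_mult_distrib)
  finally have "(norm (c *\<^sub>C x))\<^sup>2 = (cmod c * norm x)\<^sup>2"
    using of_real_eq_iff by blast
  then show ?thesis by (simp add: power2_eq_iff_nonneg)
qed

lemma cinner_eq_inner: "cinner x y = Complex (inner x y) (inner x (\<i> *\<^sub>C y))"
  by (simp add: inner_eq_Re_cinner cinner_scaleC_right complex_eq_iff)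

lemma cmod_cinner_le: "cmod (cinner x y) \<le> 2 * norm x * norm y"
proof -
  have "cmod (cinner x y) \<le> \<bar>inner x y\<bar> + \<bar>inner x (\<i> *\<^sub>C y)\<bar>"
    using cmod_le[of "cinner x y"] by (simp add: cinner_eq_inner)
  also have "\<dots> \<le> norm x * norm y + norm x * norm (\<i> *\<^sub>C y)"
    by (intro add_mono Cauchy_Schwarz_ineq2)
  finally show ?thesis by (simp add: norm_scaleC)
qed

text \<open>
  The imaginary part of the inner product of \<open>x\<close> and \<open>y\<close> is the real inner product of \<open>x\<close> and \<open>iy\<close>,
  so real polarization suffices.
\<close>

lemma norm_preserving_imp_cinner_preserving:
  fixes V :: "'a::complex_inner \<Rightarrow> 'b::complex_inner"
  assumes "csubspace D"
    and add: "\<And>x y. x \<in> D \<Longrightarrow> y \<in> D \<Longrightarrow> V (x + y) = V x + V y"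
    and scale: "\<And>c x. x \<in> D \<Longrightarrow> V (c *\<^sub>C x) = c *\<^sub>C V x"
    and norm: "\<And>x. x \<in> D \<Longrightarrow> norm (V x) = norm x"
    and "x \<in> D" "y \<in> D"
  shows "cinner (V x) (V y) = cinner x y"
proof -
  have "inner (V x) (V z) = inner x z" if "z \<in> D" for z
    using \<open>x \<in> D\<close> that complex_vector.subspace_add[OF \<open>csubspace D\<close> \<open>x \<in> D\<close> that]
    by (simp add: dot_norm norm flip: add)
  from this[OF \<open>y \<in> D\<close>] this[OF complex_vector.subspace_scale[OF \<open>csubspace D\<close> \<open>y \<in> D\<close>], of \<i>]
  show ?thesis by (simp add: cinner_eq_inner scale \<open>y \<in> D\<close>)
qed

text \<open>
  Graphs of operators and of functionals are treated as subspaces of product spaces; these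
  instances make the results on Hilbert spaces available for them.
\<close>

instantiation complex :: complex_inner
begin
definition scaleC_complex :: "complex \<Rightarrow> complex \<Rightarrow> complex" where "scaleC_complex = (*)"
definition cinner_complex :: "complex \<Rightarrow> complex \<Rightarrow> complex" where "cinner_complex x y = x * cnj y"
instance
  by standard (simp_all add: scaleC_complex_def cinner_complex_def algebra_simps scaleR_conv_of_real
      inner_complex_def)
end

instance complex :: chilbert_space ..

instantiation prod :: (complex_inner, complex_inner) complex_inner
begin
definition scaleC_prod :: "complex \<Rightarrow> 'a \<times> 'b \<Rightarrow> 'a \<times> 'b"
  where "scaleC_prod c p = (c *\<^sub>C fst p, c *\<^sub>C snd p)"
definition cinner_prod :: "'a \<times> 'b \<Rightarrow> 'a \<times> 'b \<Rightarrow> complex"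
  where "cinner_prod p q = cinner (fst p) (fst q) + cinner (snd p) (snd q)"
instance
proof
  fix x y z :: "'a \<times> 'b" and a b :: complex and r :: real
  show "a *\<^sub>C (x + y) = a *\<^sub>C x + a *\<^sub>C y" "(a + b) *\<^sub>C x = a *\<^sub>C x + b *\<^sub>C x"
    "a *\<^sub>C (b *\<^sub>C x) = (a * b) *\<^sub>C x" "1 *\<^sub>C x = x" "r *\<^sub>R x = complex_of_real r *\<^sub>C x"
    by (simp_all add: scaleC_prod_def scaleC_add_left scaleC_add_right scaleC_scaleC scaleC_one
        prod_eq_iff scaleR_eq_scaleC)
  show "cinner x y = cnj (cinner y x)"
    unfolding cinner_prod_def by (subst (1 2) cinner_commute) simp
  show "cinner (x + y) z = cinner x z + cinner y z" "cinner (a *\<^sub>C x) y = a * cinner x y"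
    "inner x y = Re (cinner x y)"
    by (simp_all add: scaleC_prod_def cinner_prod_def inner_prod_def cinner_add_left
        cinner_scaleC_left inner_eq_Re_cinner algebra_simps)
qed
end

instance prod :: (chilbert_space, chilbert_space) chilbert_space ..

lemma scaleC_Pair: "c *\<^sub>C (x, y) = (c *\<^sub>C x, c *\<^sub>C y)"
  by (simp add: scaleC_prod_def)

section \<open>Bounded complex-linear maps and closed subspaces\<close>

definition bounded_clinear :: "('a::complex_inner \<Rightarrow> 'b::complex_inner) \<Rightarrow> bool" where
  "bounded_clinear f \<longleftrightarrow> bounded_linear f \<and> (\<forall>c x. f (c *\<^sub>C x) = c *\<^sub>C f x)"

lemma bounded_clinearI:
  assumes "\<And>x y. f (x + y) = f x + f y" "\<And>c x. f (c *\<^sub>C x) = c *\<^sub>C f x"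
    "\<And>x. norm (f x) \<le> C * norm x"
  shows "bounded_clinear f"
proof -
  have "bounded_linear f"
    by (rule bounded_linear_intro[where K=C])
      (simp_all add: assms scaleR_eq_scaleC mult.commute)
  then show ?thesis by (simp add: bounded_clinear_def assms)
qed

lemma bounded_clinear_scaleC: "bounded_clinear (\<lambda>x. c *\<^sub>C x)"
  by (rule bounded_clinearI[where C="cmod c"])
    (simp_all add: scaleC_add_right scaleC_scaleC norm_scaleC mult.commute)

lemma bounded_clinear_cinner_left: "bounded_clinear (\<lambda>x. cinner x y)"
  by (rule bounded_clinearI[where C="2 * norm y"])
    (use cmod_cinner_le[of _ y] in \<open>simp_all add: cinner_add_left cinner_scaleC_left scaleC_complex_def mult_ac\<close>)

lemma bounded_clinear_compose:
  "bounded_clinear f \<Longrightarrow> bounded_clinear g \<Longrightarrow> bounded_clinear (\<lambda>x. f (g x))"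
  by (simp add: bounded_clinear_def bounded_linear_compose)

lemma bounded_clinear_diff:
  "bounded_clinear f \<Longrightarrow> bounded_clinear g \<Longrightarrow> bounded_clinear (\<lambda>x. f x - g x)"
  by (simp add: bounded_clinear_def bounded_linear_sub complex_vector.scale_right_diff_distrib)

lemma bounded_clinear_simps:
  assumes "bounded_clinear f"
  shows "f (x + y) = f x + f y" "f (x - y) = f x - f y" "f (c *\<^sub>C x) = c *\<^sub>C f x" "f 0 = 0"
  using assms unfolding bounded_clinear_def
  by (simp_all add: linear_simps)

lemma bounded_clinear_continuous: "bounded_clinear f \<Longrightarrow> continuous_on A f"
  by (simp add: bounded_clinear_def linear_continuous_on)

lemma closed_csubspace_equalizer:
  assumes "bounded_clinear f" "bounded_clinear g"
  shows "closed_csubspace {x. f x = g x}"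
  unfolding closed_csubspace_def
  using assms
  by (auto simp: complex_vector.subspace_def bounded_clinear_simps
      intro!: closed_Collect_eq bounded_clinear_continuous)

lemma csubspace_closure:
  fixes W :: "'a::complex_inner set"
  assumes W: "csubspace W"
  shows "csubspace (closure W)"
  unfolding complex_vector.subspace_def
proof (intro conjI ballI allI)
  show "0 \<in> closure W"
    using W closure_subset[of W] by (auto simp: complex_vector.subspace_def)
next
  fix x y assume x: "x \<in> closure W" and y: "y \<in> closure W"
  obtain f where f: "\<And>n. f n \<in> W" "f \<longlonglongrightarrow> x" using x closure_sequential by metis
  obtain g where g: "\<And>n. g n \<in> W" "g \<longlonglongrightarrow> y" using y closure_sequential by metis
  from f g have "\<And>n. f n + g n \<in> W" "(\<lambda>n. f n + g n) \<longlonglongrightarrow> x + y"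
    using W by (auto simp: complex_vector.subspace_def intro: tendsto_add)
  then show "x + y \<in> closure W"
    unfolding closure_sequential by (intro exI[of _ "\<lambda>n. f n + g n"]) blast
next
  fix c x assume x: "x \<in> closure W"
  have "(\<lambda>x. c *\<^sub>C x) ` closure W \<subseteq> closure W"
    using W closure_subset[of W]
    by (intro image_closure_subset bounded_clinear_continuous bounded_clinear_scaleC)
      (auto simp: complex_vector.subspace_def)
  with x show "c *\<^sub>C x \<in> closure W" by blast
qed

definition closed_cspan :: "'a::complex_inner set \<Rightarrow> 'a set" where
  "closed_cspan E = closure (cspan E)"

lemma closed_csubspace_closed_cspan: "closed_csubspace (closed_cspan E)"
  unfolding closed_csubspace_def closed_cspan_def
  by (simp add: csubspace_closure complex_vector.subspace_span)

lemma closed_cspan_superset: "E \<subseteq> closed_cspan E"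
  unfolding closed_cspan_def using closure_subset complex_vector.span_superset by fastforce

lemma closed_cspan_minimal: "closed_csubspace M \<Longrightarrow> E \<subseteq> M \<Longrightarrow> closed_cspan E \<subseteq> M"
  unfolding closed_cspan_def closed_csubspace_def
  by (simp add: closure_minimal complex_vector.span_minimal)

lemma equal_on_closed_cspan:
  assumes "x \<in> closed_cspan E" "bounded_clinear f" "bounded_clinear g" "\<And>e. e \<in> E \<Longrightarrow> f e = g e"
  shows "f x = g x"
  using closed_cspan_minimal[OF closed_csubspace_equalizer[OF assms(2,3)], of E] assms(1,4) by blast

lemma maps_closed_cspan:
  assumes "x \<in> closed_cspan E" "bounded_clinear f" "closed_csubspace M" "\<And>e. e \<in> E \<Longrightarrow> f e \<in> M"
  shows "f x \<in> M"
proof -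
  have "closed (f -` M)"
    using assms(2,3) continuous_closed_vimage[of M f] 
    by (simp add: bounded_clinear_def closed_csubspace_def linear_continuous_at)
  moreover have "csubspace (f -` M)"
    using assms(2,3) by (simp add: complex_vector.subspace_def closed_csubspace_def bounded_clinear_simps)
  ultimately have "closed_csubspace (f -` M)" by (simp add: closed_csubspace_def)
  from closed_cspan_minimal[OF this, of E] assms(1,4) show ?thesis by blast
qed

lemma cspan_image_explicit:
  assumes "x \<in> cspan (h ` E)"
  obtains A c where "finite A" "A \<subseteq> E" "x = (\<Sum>e\<in>A. c e *\<^sub>C h e)"
proof -
  obtain a c where a: "finite a" "a \<subseteq> h ` E" "x = (\<Sum>v\<in>a. c v *\<^sub>C v)"
    using assms unfolding complex_vector.span_explicit by blast
  then obtain A where A: "A \<subseteq> E" "inj_on h A" "a = h ` A"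
    by (meson subset_image_inj)
  with a have "finite A" "x = (\<Sum>e\<in>A. c (h e) *\<^sub>C h e)"
    by (auto simp: sum.reindex finite_image_iff)
  with A that[of A "\<lambda>e. c (h e)"] show thesis by blast
qed

lemma sum_in_cspan_image:
  assumes "A \<subseteq> E"
  shows "(\<Sum>e\<in>A. c e *\<^sub>C h e) \<in> cspan (h ` E)"
  using assms
  by (intro complex_vector.span_sum complex_vector.span_scale complex_vector.span_base) auto


section \<open>Riesz representation and orthogonal projections\<close>

text \<open>
  The functional to be represented is given by its graph \<open>W\<close>, so that no proof of its
  well-definedness is needed beforehand.  The representing vector is the limit of a minimizing
  sequence of \<open>J(x, z) = \<parallel>x\<parallel>\<^sup>2 - 2 Re z\<close> on \<open>W\<close>: the parallelogram law makes the sequence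
  Cauchy, and the first variation of \<open>J\<close> at the limit gives the representation.
\<close>

lemma riesz_relation:
  fixes W :: "('b::chilbert_space \<times> complex) set"
  assumes W: "csubspace W"
    and bound: "\<And>x z. (x, z) \<in> W \<Longrightarrow> 0 \<le> (norm x)\<^sup>2 - 2 * Re z + B"
  obtains r where "r \<in> closure (fst ` W)" "\<And>x z. (x, z) \<in> W \<Longrightarrow> cinner x r = z" "(norm r)\<^sup>2 \<le> B"
proof -
  define J where "J w = (norm (fst w))\<^sup>2 - 2 * Re (snd w)" for w :: "'b \<times> complex"
  define \<delta> where "\<delta> n = inverse (real (Suc n))" for n
  define d where "d = Inf (J ` W)"
  have lower: "- B \<le> J w" if "w \<in> W" for w
    using bound[of "fst w" "snd w"] that by (simp add: J_def)
  then have "bdd_below (J ` W)" by (intro bdd_belowI2)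
  then have d_le: "d \<le> J w" if "w \<in> W" for w
    unfolding d_def using that by (rule cINF_lower)
  have "J ` W \<noteq> {}" using W by (auto simp: complex_vector.subspace_def)
  then have "\<exists>w\<in>W. J w < d + \<delta> n" for n
    using cInf_lessD[of "J ` W" "d + \<delta> n"] by (auto simp: \<delta>_def simp flip: d_def)
  then obtain w where w: "\<And>n. w n \<in> W" and Jw: "\<And>n. J (w n) < d + \<delta> n" by metis
  define x where "x n = fst (w n)" for n
  \<comment> \<open>The parallelogram law for \<open>u\<close> and \<open>v\<close>, with the infimum as a bound at their midpoint.\<close>
  have gap: "(norm (fst u - fst v))\<^sup>2 \<le> 2 * (J u - d) + 2 * (J v - d)" if "u \<in> W" "v \<in> W" for u v
  proof -
    have "(1/2) *\<^sub>C (u + v) \<in> W"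
      using W that by (simp add: complex_vector.subspace_def)
    then have "d \<le> J ((1/2) *\<^sub>C (u + v))" by (rule d_le)
    also have "\<dots> = (norm (fst u + fst v))\<^sup>2 / 4 - Re (snd u) - Re (snd v)"
      by (simp add: J_def scaleC_prod_def norm_scaleC scaleC_complex_def power_mult_distrib power_divide norm_divide add_divide_distrib)
    finally show ?thesis
      unfolding J_def power2_norm_eq_inner by (simp add: inner_simps inner_commute field_simps)
  qed
  have "Cauchy x"
  proof (rule CauchyI)
    fix e :: real assume "e > 0"
    then obtain N where N: "\<delta> N < e\<^sup>2 / 4"
      using reals_Archimedean[of "e\<^sup>2 / 4"] by (auto simp: \<delta>_def)
    have "norm (x m - x n) < e" if "m \<ge> N" "n \<ge> N" for m n
    proof -
      have "\<delta> m \<le> \<delta> N" "\<delta> n \<le> \<delta> N"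
        using that by (auto simp: \<delta>_def intro!: le_imp_inverse_le)
      moreover have "J (w m) - d < \<delta> m" "J (w n) - d < \<delta> n"
        using Jw[of m] Jw[of n] by linarith+
      ultimately have "(norm (x m - x n))\<^sup>2 < e\<^sup>2"
        using gap[OF w w, of m n] N unfolding x_def by argo
      then show ?thesis using \<open>e > 0\<close> by (simp add: power_less_imp_less_base)
    qed
    then show "\<exists>M. \<forall>m\<ge>M. \<forall>n\<ge>M. norm (x m - x n) < e" by blast
  qed
  then obtain r where r: "x \<longlonglongrightarrow> r" by (auto simp: Cauchy_convergent_iff convergent_def)
  have inv0: "\<delta> \<longlonglongrightarrow> 0"
    unfolding \<delta>_def by (rule LIMSEQ_inverse_real_of_nat)
  have Re_eq: "inner y r = Re z" if yz: "(y, z) \<in> W" for y z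
  proof -
    define a where "a = inner y r - Re z"
    have "0 \<le> t\<^sup>2 * (norm y)\<^sup>2 + 2 * t * a" for t
    proof (rule tendsto_lowerbound)
      have lim: "(\<lambda>n. t\<^sup>2 * (norm y)\<^sup>2 + 2 * t * (inner y (x n) - Re z))
              \<longlonglongrightarrow> t\<^sup>2 * (norm y)\<^sup>2 + 2 * t * (inner y r - Re z)"
        by (intro tendsto_intros r)
      show "(\<lambda>n. \<delta> n + (t\<^sup>2 * (norm y)\<^sup>2 + 2 * t * (inner y (x n) - Re z)))
              \<longlonglongrightarrow> t\<^sup>2 * (norm y)\<^sup>2 + 2 * t * a"
        unfolding a_def using tendsto_add[OF inv0 lim] by simp
      have "0 \<le> \<delta> n + (t\<^sup>2 * (norm y)\<^sup>2 + 2 * t * (inner y (x n) - Re z))" for n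
      proof -
        have "w n + complex_of_real t *\<^sub>C (y, z) \<in> W"
          using W w yz by (simp add: complex_vector.subspace_def)
        then have "d \<le> J (w n + complex_of_real t *\<^sub>C (y, z))" by (rule d_le)
        also have "\<dots> = J (w n) + (t\<^sup>2 * (norm y)\<^sup>2 + 2 * t * (inner y (x n) - Re z))"
          unfolding J_def x_def scaleR_eq_scaleC[symmetric] power2_norm_eq_inner
          by (simp add: inner_simps inner_commute power2_eq_square algebra_simps)
        finally show ?thesis using Jw[of n] by linarith
      qed
      then show "\<forall>\<^sub>F n in sequentially. 0 \<le> \<delta> n + (t\<^sup>2 * (norm y)\<^sup>2 + 2 * t * (inner y (x n) - Re z))"
        by simp
    qed simp
    \<comment> \<open>A quadratic polynomial in \<open>t\<close> without constant term is nonnegative only if its linear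
        coefficient vanishes; this choice of \<open>t\<close> is legitimate also for \<open>y = 0\<close>.\<close>
    from this[of "- a / ((norm y)\<^sup>2 + 1)"]
    have "0 \<le> a\<^sup>2 * (norm y)\<^sup>2 / ((norm y)\<^sup>2 + 1)\<^sup>2 - 2 * a\<^sup>2 / ((norm y)\<^sup>2 + 1)"
      by (simp add: power_divide power2_eq_square[of a])
    moreover have "a\<^sup>2 * (norm y)\<^sup>2 / ((norm y)\<^sup>2 + 1)\<^sup>2 \<le> a\<^sup>2 / ((norm y)\<^sup>2 + 1)"
    proof -
      have "a\<^sup>2 * (norm y)\<^sup>2 \<le> a\<^sup>2 * ((norm y)\<^sup>2 + 1)" by (intro mult_left_mono) auto
      moreover have "(norm y)\<^sup>2 + 1 > 0" by (simp add: add_nonneg_pos)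
      ultimately show ?thesis
        by (simp add: divide_simps power2_eq_square[of "(norm y)\<^sup>2 + 1"])
    qed
    ultimately have "a\<^sup>2 / ((norm y)\<^sup>2 + 1) \<le> 0" by linarith
    moreover have "(norm y)\<^sup>2 + 1 > 0" by (simp add: add_nonneg_pos)
    ultimately have "a = 0" by (simp add: divide_le_0_iff)
    then show ?thesis by (simp add: a_def)
  qed
  have "cinner y r = z" if yz: "(y, z) \<in> W" for y z
  proof -
    have "(\<i> *\<^sub>C y, \<i> * z) \<in> W"
      using complex_vector.subspace_scale[OF W yz, of \<i>] by (simp add: scaleC_Pair scaleC_complex_def)
    from Re_eq[OF this] Re_eq[OF yz] show ?thesis
      by (simp add: inner_eq_Re_cinner cinner_scaleC_left complex_eq_iff)
  qed
  moreover have "r \<in> closure (fst ` W)"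
    unfolding closure_sequential using r w by (auto simp: x_def intro!: exI[of _ x])
  moreover have "(norm r)\<^sup>2 \<le> B"
  proof (rule tendsto_upperbound)
    have "(\<lambda>n. 2 * inner (x n) r - (norm (x n))\<^sup>2) \<longlonglongrightarrow> 2 * inner r r - (norm r)\<^sup>2"
      by (intro tendsto_intros r)
    then show "(\<lambda>n. 2 * inner (x n) r - (norm (x n))\<^sup>2) \<longlonglongrightarrow> (norm r)\<^sup>2"
      by (simp add: power2_norm_eq_inner)
    have "2 * inner (x n) r - (norm (x n))\<^sup>2 \<le> B" for n
      using lower[OF w[of n]] Re_eq[of "x n" "snd (w n)"] w[of n] by (simp add: J_def x_def)
    then show "\<forall>\<^sub>F n in sequentially. 2 * inner (x n) r - (norm (x n))\<^sup>2 \<le> B" by simp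
  qed simp
  ultimately show thesis using that by blast
qed

lemma orthogonal_projection:
  fixes M :: "'b::chilbert_space set"
  assumes M: "closed_csubspace M"
  obtains P where "bounded_clinear P" "\<And>x. P x \<in> M" "\<And>x. x \<in> M \<Longrightarrow> P x = x"
    "\<And>x m. m \<in> M \<Longrightarrow> cinner m (x - P x) = 0"
proof -
  have sub: "csubspace M" and "closed M" using M by (auto simp: closed_csubspace_def)
  have "\<exists>p. p \<in> M \<and> (\<forall>m\<in>M. cinner m p = cinner m x) \<and> (norm p)\<^sup>2 \<le> (norm x)\<^sup>2" for x :: 'b
  proof -
    define W where "W = (\<lambda>m. (m, cinner m x)) ` M"
    have "csubspace W"
      using sub unfolding complex_vector.subspace_def W_def
      by (auto simp: image_iff zero_prod_def scaleC_Pair cinner_add_left cinner_scaleC_left scaleC_complex_def)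
    moreover have "0 \<le> (norm m)\<^sup>2 - 2 * Re z + (norm x)\<^sup>2" if "(m, z) \<in> W" for m z
    proof -
      have "z = cinner m x" using that by (auto simp: W_def)
      then have "(norm m)\<^sup>2 - 2 * Re z + (norm x)\<^sup>2 = (norm (m - x))\<^sup>2"
        by (simp add: power2_norm_eq_inner inner_eq_Re_cinner[symmetric] inner_simps inner_commute)
      then show ?thesis by simp
    qed
    ultimately obtain r where "r \<in> closure (fst ` W)" "\<And>y z. (y, z) \<in> W \<Longrightarrow> cinner y r = z"
      "(norm r)\<^sup>2 \<le> (norm x)\<^sup>2"
      using riesz_relation by blast
    moreover have "fst ` W = M" by (auto simp: W_def image_image)
    ultimately show ?thesis using \<open>closed M\<close> by (auto simp: W_def)
  qed
  then obtain P where P: "\<And>x. P x \<in> M" "\<And>x m. m \<in> M \<Longrightarrow> cinner m (P x) = cinner m x"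
    "\<And>x. (norm (P x))\<^sup>2 \<le> (norm x)\<^sup>2" by metis
  have unique: "y = P x" if "y \<in> M" "\<And>m. m \<in> M \<Longrightarrow> cinner m y = cinner m x" for x y
  proof -
    have "y - P x \<in> M" using sub that P(1) by (simp add: complex_vector.subspace_diff)
    then have "cinner (y - P x) (y - P x) = 0" by (simp only: cinner_diff_right that(2) P(2) diff_self)
    then show ?thesis by (simp add: cinner_self_eq_0)
  qed
  show thesis
  proof (rule that[of P])
    show "bounded_clinear P"
    proof (rule bounded_clinearI[where C=1])
      show "P (x + y) = P x + P y" for x y
        using sub P by (intro unique[symmetric]) (auto simp: complex_vector.subspace_add cinner_add_right)
      show "P (c *\<^sub>C x) = c *\<^sub>C P x" for c x
        using sub P by (intro unique[symmetric]) (auto simp: complex_vector.subspace_scale cinner_scaleC_right)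
      show "norm (P x) \<le> 1 * norm x" for x
        using P(3)[of x] by simp
    qed
  qed (use P unique in \<open>auto simp: cinner_diff_right\<close>)
qed

text \<open>
  The closed span of the pairs \<open>(p e, q e)\<close> is the graph of a contraction defined on a closed
  subspace; composing it with the orthogonal projection onto that subspace makes it total.
\<close>

lemma bounded_clinear_from_generators:
  fixes p :: "'e \<Rightarrow> 'b::chilbert_space" and q :: "'e \<Rightarrow> 'c::chilbert_space"
  assumes le: "\<And>A c. finite A \<Longrightarrow> norm (\<Sum>e\<in>A. c e *\<^sub>C q e) \<le> norm (\<Sum>e\<in>A. c e *\<^sub>C p e)"
  obtains T where "bounded_clinear T" "\<And>e. T (p e) = q e"
proof -
  define G where "G = closed_cspan (range (\<lambda>e. (p e, q e)))"
  have G: "csubspace G" "closed G"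
    using closed_csubspace_closed_cspan unfolding G_def closed_csubspace_def by blast+
  have norm_le: "norm y \<le> norm x" if "(x, y) \<in> G" for x y
  proof -
    have "G \<subseteq> {w. norm (snd w) \<le> norm (fst w)}"
      unfolding G_def closed_cspan_def
    proof (rule closure_minimal)
      show "cspan (range (\<lambda>e. (p e, q e))) \<subseteq> {w. norm (snd w) \<le> norm (fst w)}"
      proof
        fix w assume "w \<in> cspan (range (\<lambda>e. (p e, q e)))"
        then obtain A c where "finite A" and w: "w = (\<Sum>e\<in>A. c e *\<^sub>C (p e, q e))"
          by (rule cspan_image_explicit)
        then show "w \<in> {w. norm (snd w) \<le> norm (fst w)}"
          using le[OF \<open>finite A\<close>, of c] by (simp add: fst_sum snd_sum scaleC_Pair)
      qed
      show "closed {w. norm (snd w) \<le> norm (fst w :: 'b)}"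
        by (intro closed_Collect_le continuous_intros)
    qed
    with that show ?thesis by auto
  qed
  have unique: "y = y'" if "(x, y) \<in> G" "(x, y') \<in> G" for x y y'
    using norm_le[of 0 "y - y'"] complex_vector.subspace_diff[OF G(1) that] by simp
  have "closed (fst ` G)"
    unfolding closed_sequential_limits
  proof (intro allI impI, elim conjE)
    fix x l assume "\<forall>n. x n \<in> fst ` G" and x: "x \<longlonglongrightarrow> l"
    then have "\<forall>n. \<exists>y. (x n, y) \<in> G" by force
    then obtain y where y: "\<And>n. (x n, y n) \<in> G" by metis
    have "Cauchy x" using x LIMSEQ_imp_Cauchy by blast
    have "Cauchy y"
    proof (rule CauchyI)
      fix e :: real assume "e > 0"
      then obtain M where M: "\<And>m n. m \<ge> M \<Longrightarrow> n \<ge> M \<Longrightarrow> norm (x m - x n) < e"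
        using CauchyD[OF \<open>Cauchy x\<close>] by blast
      have "norm (y m - y n) \<le> norm (x m - x n)" for m n
        using complex_vector.subspace_diff[OF G(1) y[of m] y[of n]] by (intro norm_le) simp
      from order_le_less_trans[OF this M]
      show "\<exists>M. \<forall>m\<ge>M. \<forall>n\<ge>M. norm (y m - y n) < e" by blast
    qed
    then obtain k where "y \<longlonglongrightarrow> k" by (auto simp: Cauchy_convergent_iff convergent_def)
    with x have "(\<lambda>n. (x n, y n)) \<longlonglongrightarrow> (l, k)" by (rule tendsto_Pair)
    then have "(l, k) \<in> G"
      using closed_sequentially[OF G(2), of "\<lambda>n. (x n, y n)"] y by simp
    then show "l \<in> fst ` G" by (intro image_eqI[of _ fst "(l, k)"]) simp_all
  qed
  moreover have "csubspace (fst ` G)"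
    unfolding complex_vector.subspace_def
  proof (intro conjI ballI allI)
    show "0 \<in> fst ` G"
      using complex_vector.subspace_0[OF G(1)] by (intro image_eqI[of _ fst 0]) simp_all
  next
    fix x y assume "x \<in> fst ` G" "y \<in> fst ` G"
    then obtain a b where "(x, a) \<in> G" "(y, b) \<in> G" by auto
    from complex_vector.subspace_add[OF G(1) this] show "x + y \<in> fst ` G"
      by (intro image_eqI[of _ fst "(x + y, a + b)"]) simp_all
  next
    fix c x assume "x \<in> fst ` G"
    then obtain a where "(x, a) \<in> G" by auto
    from complex_vector.subspace_scale[OF G(1) this, of c] show "c *\<^sub>C x \<in> fst ` G"
      by (intro image_eqI[of _ fst "(c *\<^sub>C x, c *\<^sub>C a)"]) (simp_all add: scaleC_Pair)
  qed
  ultimately have dom: "closed_csubspace (fst ` G)" by (simp add: closed_csubspace_def)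
  obtain P where P: "bounded_clinear P" "\<And>x. P x \<in> fst ` G" "\<And>x. x \<in> fst ` G \<Longrightarrow> P x = x"
    and "\<And>x m. m \<in> fst ` G \<Longrightarrow> cinner m (x - P x) = 0"
    by (rule orthogonal_projection[OF dom]) (rule that, assumption+)
  define T where "T x = (THE y. (P x, y) \<in> G)" for x
  have T: "(P x, T x) \<in> G" for x
  proof -
    obtain y where y: "(P x, y) \<in> G" using P(2)[of x] by auto
    show ?thesis
      unfolding T_def by (rule theI[where a=y]) (use y unique in \<open>blast+\<close>)
  qed
  have gen: "(p e, q e) \<in> G" for e
    using closed_cspan_superset[of "range (\<lambda>e. (p e, q e))"] by (auto simp: G_def)
  obtain C where C: "\<And>x. norm (P x) \<le> C * norm x"
    using P(1) bounded_linear.bounded[of P] by (auto simp: bounded_clinear_def mult.commute)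
  show thesis
  proof (rule that[of T])
    show "bounded_clinear T"
    proof (rule bounded_clinearI[where C=C])
      show "T (x + y) = T x + T y" for x y
        using complex_vector.subspace_add[OF G(1) T T, of x y]
        by (intro unique[OF T]) (simp add: bounded_clinear_simps[OF P(1)])
      show "T (c *\<^sub>C x) = c *\<^sub>C T x" for c x
        using complex_vector.subspace_scale[OF G(1) T, of c x]
        by (intro unique[OF T]) (simp add: bounded_clinear_simps[OF P(1)] scaleC_Pair)
      show "norm (T x) \<le> C * norm x" for x
        by (rule order_trans[OF norm_le[OF T] C])
    qed
    show "T (p e) = q e" for e
    proof (rule unique)
      have "P (p e) = p e" using gen[of e] by (intro P(3)) force
      with T[of "p e"] show "(p e, T (p e)) \<in> G" by simp
    qed (rule gen)
  qed
qed


section \<open>Positive definite kernels\<close>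

lift_definition unit_ell2 :: "'i \<Rightarrow> 'i ell2" is "\<lambda>i j. if j = i then 1 else 0"
proof -
  fix i :: 'i
  have "(\<lambda>j. (cmod (if j = i then 1 else 0))\<^sup>2) summable_on {i}" by simp
  then show "(\<lambda>j. (cmod (if j = i then 1 else 0))\<^sup>2) summable_on UNIV"
    by (rule summable_on_cong_neutral[THEN iffD1, rotated -1]) auto
qed

lemma cinner_unit_ell2: "cinner x (unit_ell2 i) = Rep_ell2 x i"
proof transfer
  fix f :: "'a \<Rightarrow> complex" and i
  have "(\<Sum>\<^sub>\<infinity>j. f j * cnj (if j = i then 1 else 0)) = (\<Sum>\<^sub>\<infinity>j\<in>{i}. f j)"
    by (rule infsum_cong_neutral) auto
  then show "(\<Sum>\<^sub>\<infinity>j. f j * cnj (if j = i then 1 else 0)) = f i" by simp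
qed

lemma cinner_unit_ell2_self: "cinner (unit_ell2 i) (unit_ell2 i) = 1"
  unfolding cinner_unit_ell2 by transfer simp

lemma cinner_combination:
  "cinner (\<Sum>s\<in>A. c s *\<^sub>C x s) (\<Sum>t\<in>A. c t *\<^sub>C x t) = (\<Sum>s\<in>A. \<Sum>t\<in>A. c s * cnj (c t) * cinner (x s) (x t))"
  by (simp add: cinner_sum_left cinner_sum_right cinner_scaleC_left cinner_scaleC_right mult_ac
      sum_distrib_left, subst sum.swap, rule refl)

text \<open>
  One step of the Gram-Schmidt procedure: the new vector is the sum of a component \<open>r\<close> in the
  closed span of the old ones, determined by the prescribed inner products, and of a multiple of
  the unit vector of a coordinate \<open>i\<close> that the old vectors do not use, which corrects the norm.
  Positivity of the kernel says that the norm of \<open>r\<close> does not exceed the prescribed one.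
\<close>

lemma Gram_representation_insert:
  fixes k :: "'e \<Rightarrow> 'e \<Rightarrow> complex" and y :: "'e \<Rightarrow> 'i ell2"
  assumes hermitian: "\<And>s t. k s t = cnj (k t s)"
    and pos: "\<And>A c. finite A \<Longrightarrow> 0 \<le> Re (\<Sum>s\<in>A. \<Sum>t\<in>A. c s * cnj (c t) * k s t)"
    and y: "\<And>t u. t \<in> D \<Longrightarrow> u \<in> D \<Longrightarrow> cinner (y t) (y u) = k t u"
    and free: "\<And>t. t \<in> D \<Longrightarrow> Rep_ell2 (y t) i = 0" and s: "s \<notin> D"
  obtains r a where "\<And>t. t \<in> D \<Longrightarrow> cinner (y t) (r + a *\<^sub>C unit_ell2 i) = k t s"
    "cinner (r + a *\<^sub>C unit_ell2 i) (r + a *\<^sub>C unit_ell2 i) = k s s" "r \<in> closed_cspan (y ` D)"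
proof -
  define W where "W = cspan ((\<lambda>t. (y t, k t s)) ` D)"
  have W: "csubspace W" unfolding W_def by (rule complex_vector.subspace_span)
  have bound: "0 \<le> (norm x)\<^sup>2 - 2 * Re z + Re (k s s)" if xz_in: "(x, z) \<in> W" for x z
  proof -
    obtain A c where A: "finite A" "A \<subseteq> D" and xz: "(x, z) = (\<Sum>t\<in>A. c t *\<^sub>C (y t, k t s))"
      using xz_in unfolding W_def by (rule cspan_image_explicit)
    have x: "x = (\<Sum>t\<in>A. c t *\<^sub>C y t)"
      using arg_cong[OF xz, of fst] by (simp add: fst_sum scaleC_Pair)
    have z: "z = (\<Sum>t\<in>A. c t * k t s)"
      using arg_cong[OF xz, of snd] by (simp add: snd_sum scaleC_Pair scaleC_complex_def)
    \<comment> \<open>Positivity is applied to the prospective vector minus the combination \<open>x\<close>.\<close>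
    define c' where "c' = c(s := - 1)"
    have sA: "s \<notin> A" using A s by blast
    have c': "c' t = c t" if "t \<in> A" for t using that sA by (auto simp: c'_def)
    have cs: "c' s = - 1" by (simp add: c'_def)
    have zc: "(\<Sum>u\<in>A. cnj (c u) * k s u) = cnj z"
      unfolding z cnj_sum by (intro sum.cong refl) (simp add: hermitian[of s])
    have "complex_of_real ((norm x)\<^sup>2) = (\<Sum>t\<in>A. \<Sum>u\<in>A. c t * cnj (c u) * k t u)"
      unfolding cinner_self[symmetric] x cinner_combination
      using A y by (intro sum.cong refl) (auto simp: subset_iff)
    then have xx: "(norm x)\<^sup>2 = Re (\<Sum>t\<in>A. \<Sum>u\<in>A. c t * cnj (c u) * k t u)"
      by (metis Re_complex_of_real)
    have "0 \<le> Re (\<Sum>t\<in>insert s A. \<Sum>u\<in>insert s A. c' t * cnj (c' u) * k t u)"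
      using A by (intro pos) simp
    also have "(\<Sum>t\<in>insert s A. \<Sum>u\<in>insert s A. c' t * cnj (c' u) * k t u)
        = k s s - (\<Sum>u\<in>A. cnj (c u) * k s u) - (\<Sum>t\<in>A. c t * k t s)
          + (\<Sum>t\<in>A. \<Sum>u\<in>A. c t * cnj (c u) * k t u)"
      using A sA by (simp add: cs c' sum.distrib sum_negf sum_subtractf cong: sum.cong)
    finally show ?thesis unfolding xx zc z[symmetric] by simp
  qed
  obtain r where r: "r \<in> closure (fst ` W)" "\<And>x z. (x, z) \<in> W \<Longrightarrow> cinner x r = z"
    and nr: "(norm r)\<^sup>2 \<le> Re (k s s)"
    using riesz_relation[OF W bound] by blast
  have "fst ` W \<subseteq> cspan (y ` D)"
  proof
    fix x assume "x \<in> fst ` W"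
    then obtain z where "(x, z) \<in> cspan ((\<lambda>t. (y t, k t s)) ` D)" by (auto simp: W_def)
    then obtain A c where "finite A" "A \<subseteq> D" and xz: "(x, z) = (\<Sum>t\<in>A. c t *\<^sub>C (y t, k t s))"
      by (rule cspan_image_explicit)
    have "x = (\<Sum>t\<in>A. c t *\<^sub>C y t)"
      using arg_cong[OF xz, of fst] by (simp add: fst_sum scaleC_Pair)
    with \<open>A \<subseteq> D\<close> show "x \<in> cspan (y ` D)" by (simp add: sum_in_cspan_image)
  qed
  with r(1) have r_span: "r \<in> closed_cspan (y ` D)"
    unfolding closed_cspan_def using closure_mono by blast
  have yr: "cinner (y t) r = k t s" if "t \<in> D" for t
    using that by (intro r(2)) (auto simp: W_def intro: complex_vector.span_base)
  have re: "cinner r (unit_ell2 i) = 0"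
    using equal_on_closed_cspan[OF r_span bounded_clinear_cinner_left[of "unit_ell2 i"]
        bounded_clinear_cinner_left[of 0]] free
    by (auto simp: cinner_unit_ell2)
  then have er: "cinner (unit_ell2 i) r = 0" by (subst cinner_commute) simp
  define a where "a = complex_of_real (sqrt (Re (k s s) - (norm r)\<^sup>2))"
  have "k s s = complex_of_real (Re (k s s))"
    using hermitian[of s s] by (simp add: complex_eq_iff)
  moreover have "a * cnj a = complex_of_real (Re (k s s) - (norm r)\<^sup>2)"
    unfolding a_def using nr by (simp flip: of_real_mult)
  ultimately have "cinner r r + a * cnj a = k s s"
    by (simp add: cinner_self)
  then have "cinner (r + a *\<^sub>C unit_ell2 i) (r + a *\<^sub>C unit_ell2 i) = k s s"
    by (simp add: cinner_add_left cinner_add_right cinner_scaleC_left cinner_scaleC_right re er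
        cinner_unit_ell2_self mult.commute)
  moreover have "cinner (y t) (r + a *\<^sub>C unit_ell2 i) = k t s" if "t \<in> D" for t
    using that by (simp add: cinner_add_right cinner_scaleC_right yr cinner_unit_ell2 free)
  ultimately show thesis using that r_span by blast
qed

text \<open>
  The Gram-Schmidt step is iterated transfinitely, by Zorn's lemma on partial representations
  that use only the coordinates belonging to their own indices.  This yields vectors in a concrete
  space of square-summable families without the choice of an orthonormal basis.
\<close>

theorem Gram_representation:
  fixes k :: "'e \<Rightarrow> 'e \<Rightarrow> complex" and \<iota> :: "'e \<Rightarrow> 'i"
  assumes "inj \<iota>"
    and hermitian: "\<And>s t. k s t = cnj (k t s)"
    and pos: "\<And>A c. finite A \<Longrightarrow> 0 \<le> Re (\<Sum>s\<in>A. \<Sum>t\<in>A. c s * cnj (c t) * k s t)"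
  obtains \<phi> :: "'e \<Rightarrow> 'i ell2" where "\<And>s t. cinner (\<phi> s) (\<phi> t) = k s t"
proof -
  \<comment> \<open>Relations rather than partial functions are ordered by inclusion: they are single-valued
    automatically, since the inner products determine the distance of two vectors.\<close>
  define good where "good G \<longleftrightarrow> (\<forall>(s, x)\<in>G. \<forall>(t, y)\<in>G. cinner x y = k s t) \<and>
    (\<forall>(s, x)\<in>G. \<forall>i. Rep_ell2 x i \<noteq> 0 \<longrightarrow> i \<in> \<iota> ` Domain G)" for G :: "('e \<times> 'i ell2) set"
  have "\<exists>G\<in>{G. good G}. \<forall>G'\<in>{G. good G}. G \<subseteq> G' \<longrightarrow> G' = G"
  proof (rule subset_Zorn_nonempty)
    show "{G. good G} \<noteq> {}" by (auto simp: good_def intro!: exI[of _ "{}"])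
  next
    fix C assume "C \<noteq> {}" and C: "subset.chain {G. good G} C"
    have dir: "\<exists>G\<in>C. p \<in> G \<and> q \<in> G" if "p \<in> \<Union>C" "q \<in> \<Union>C" for p q
      using that C unfolding subset.chain_def by blast
    have good: "good G" if "G \<in> C" for G using that C unfolding subset.chain_def by blast
    have "cinner x y = k s t" if "(s, x) \<in> \<Union>C" "(t, y) \<in> \<Union>C" for s x t y
      using dir[OF that] good unfolding good_def by fast
    moreover have "i \<in> \<iota> ` Domain (\<Union>C)" if "(s, x) \<in> \<Union>C" "Rep_ell2 x i \<noteq> 0" for s x i
    proof -
      obtain G where "G \<in> C" "(s, x) \<in> G" using \<open>(s, x) \<in> \<Union>C\<close> by blast
      then have "i \<in> \<iota> ` Domain G" using good[of G] that(2) unfolding good_def by fast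
      with \<open>G \<in> C\<close> show ?thesis by blast
    qed
    ultimately show "\<Union>C \<in> {G. good G}" unfolding good_def by blast
  qed
  then obtain G where G: "good G" and max: "\<And>G'. good G' \<Longrightarrow> G \<subseteq> G' \<Longrightarrow> G' = G" by blast
  define y where "y t = (SOME x. (t, x) \<in> G)" for t
  have y: "(t, y t) \<in> G" if "t \<in> Domain G" for t
    using that unfolding y_def by (metis DomainE someI_ex)
  have yy: "cinner (y t) (y u) = k t u" if "t \<in> Domain G" "u \<in> Domain G" for t u
    using G y[OF that(1)] y[OF that(2)] unfolding good_def by fast
  have supp: "i \<in> \<iota> ` Domain G" if "(t, x) \<in> G" "Rep_ell2 x i \<noteq> 0" for t x i
    using G that unfolding good_def by fast
  have functional: "x = y t" if "(t, x) \<in> G" for t x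
  proof -
    have "cinner u v = k t t" if "u \<in> {x, y t}" "v \<in> {x, y t}" for u v
      using G that \<open>(t, x) \<in> G\<close> y[of t] unfolding good_def by fast
    then have "cinner (x - y t) (x - y t) = 0" by (simp add: cinner_diff_left cinner_diff_right)
    then show ?thesis by (simp add: cinner_self_eq_0)
  qed
  have total: "s \<in> Domain G" for s
  proof (rule ccontr)
    assume s: "s \<notin> Domain G"
    have free: "Rep_ell2 (y t) (\<iota> s) = 0" if "t \<in> Domain G" for t
      using supp[OF y[OF that], of "\<iota> s"] s inj_image_mem_iff[OF \<open>inj \<iota>\<close>] by blast
    obtain r a where ra: "\<And>t. t \<in> Domain G \<Longrightarrow> cinner (y t) (r + a *\<^sub>C unit_ell2 (\<iota> s)) = k t s"
      "cinner (r + a *\<^sub>C unit_ell2 (\<iota> s)) (r + a *\<^sub>C unit_ell2 (\<iota> s)) = k s s"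
      and r: "r \<in> closed_cspan (y ` Domain G)"
      using Gram_representation_insert[OF hermitian pos yy free s] by blast
    define x where "x = r + a *\<^sub>C unit_ell2 (\<iota> s)"
    have yx: "cinner z x = k t s" if "(t, z) \<in> G" for t z
      using ra(1)[of t] functional[OF that] that unfolding x_def by blast
    have xy: "cinner x z = k s t" if "(t, z) \<in> G" for t z
      using yx[OF that] cinner_commute[of x z] hermitian[of s t] by simp
    have xx: "cinner x x = k s s" using ra(2) by (simp only: x_def)
    have "i \<in> \<iota> ` insert s (Domain G)" if "Rep_ell2 x i \<noteq> 0" for i
    proof (rule ccontr)
      assume i: "i \<notin> \<iota> ` insert s (Domain G)"
      have "cinner r (unit_ell2 i) = 0"
        using equal_on_closed_cspan[OF r bounded_clinear_cinner_left[of "unit_ell2 i"]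
            bounded_clinear_cinner_left[of 0]] supp[OF y] i
        by (auto simp: cinner_unit_ell2)
      moreover have "Rep_ell2 (unit_ell2 (\<iota> s)) i = 0" using i by transfer auto
      ultimately show False
        using that by (simp add: x_def plus_ell2.rep_eq scaleC_ell2.rep_eq cinner_unit_ell2)
    qed
    then have "good (insert (s, x) G)"
      using G xx xy yx supp unfolding good_def by (auto; blast)
    from max[OF this] s show False by (auto simp: Domain_iff)
  qed
  show thesis by (rule that[of y]) (simp add: yy total)
qed


section \<open>Words in the bounded transforms of a normal operator\<close>

text \<open>
  The letters stand for \<open>R = (I + N\<^sup>*N)\<^sup>-\<^sup>1\<close>, \<open>Z = NR\<close> and \<open>Z\<^sup>* = N\<^sup>*R\<close>.
\<close>

datatype letter = Res | Fwd | Bwd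

instance letter :: countable
  by countable_datatype

primrec star :: "letter \<Rightarrow> letter" where
  "star Res = Res"
| "star Fwd = Bwd"
| "star Bwd = Fwd"

lemma star_star [simp]: "star (star l) = l"
  by (cases l) simp_all

lemma star_eq_Res [simp]: "star l = Res \<longleftrightarrow> l = Res"
  by (cases l) simp_all

definition prepend :: "letter \<Rightarrow> 'a \<times> letter list \<Rightarrow> 'a \<times> letter list" where
  "prepend l e = (fst e, l # snd e)"

text \<open>
  The vector \<open>\<psi>(f, w)\<close> plays the role of the word \<open>w\<close> applied to the image of \<open>f\<close> under the isometric
  embedding.  Every condition is an equation between inner products or a linear relation between
  at most three of the vectors, hence a closed condition on the Gram kernel.  Outside the domain
  of \<open>T\<close> the value is set to zero, which lets families with different domains be compared.
\<close>

definition dilation :: "'a::complex_inner operator \<Rightarrow> ('a \<times> letter list \<Rightarrow> 'b::complex_inner) \<Rightarrow> bool" where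
  "dilation T \<psi> \<longleftrightarrow>
     (\<forall>f w. f \<notin> Domain T \<longrightarrow> \<psi> (f, w) = 0) \<and>
     (\<forall>f\<in>Domain T. \<forall>g\<in>Domain T. cinner (\<psi> (f, [])) (\<psi> (g, [])) = cinner f g) \<and>
     (\<forall>l d e. cinner (\<psi> (prepend l d)) (\<psi> e) = cinner (\<psi> d) (\<psi> (prepend (star l) e))) \<and>
     (\<forall>l e. \<psi> (prepend l (prepend Res e)) = \<psi> (prepend Res (prepend l e))) \<and>
     (\<forall>l e. l \<noteq> Res \<longrightarrow> \<psi> (prepend (star l) (prepend l e)) = \<psi> (prepend Res e) - \<psi> (prepend Res (prepend Res e))) \<and>
     (\<forall>(f, g)\<in>T. \<psi> (g, [Res]) = \<psi> (f, [Fwd]) \<and> \<psi> (f, []) = \<psi> (f, [Res]) + \<psi> (g, [Bwd]))"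

lemma dilationD:
  assumes "dilation T \<psi>"
  shows "\<And>f w. f \<notin> Domain T \<Longrightarrow> \<psi> (f, w) = 0"
    and "\<And>f g. f \<in> Domain T \<Longrightarrow> g \<in> Domain T \<Longrightarrow> cinner (\<psi> (f, [])) (\<psi> (g, [])) = cinner f g"
    and "\<And>l d e. cinner (\<psi> (prepend l d)) (\<psi> e) = cinner (\<psi> d) (\<psi> (prepend (star l) e))"
    and "\<And>l e. \<psi> (prepend l (prepend Res e)) = \<psi> (prepend Res (prepend l e))"
    and "\<And>l e. l \<noteq> Res \<Longrightarrow> \<psi> (prepend (star l) (prepend l e)) = \<psi> (prepend Res e) - \<psi> (prepend Res (prepend Res e))"
    and "\<And>f g. (f, g) \<in> T \<Longrightarrow> \<psi> (g, [Res]) = \<psi> (f, [Fwd])"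
    and "\<And>f g. (f, g) \<in> T \<Longrightarrow> \<psi> (f, []) = \<psi> (f, [Res]) + \<psi> (g, [Bwd])"
  using assms unfolding dilation_def by blast+

text \<open>
  For a combination \<open>y\<close> of the vectors, the relations give
  \<open>\<parallel>Zy\<parallel>\<^sup>2 + \<parallel>Ry\<parallel>\<^sup>2 = \<langle>y, Z\<^sup>*Z y\<rangle> + \<langle>y, R\<^sup>2 y\<rangle> = \<langle>y, R y\<rangle>\<close>, and the Cauchy-Schwarz inequality bounds
  first \<open>\<parallel>Ry\<parallel>\<close> and then \<open>\<parallel>Zy\<parallel>\<close> by \<open>\<parallel>y\<parallel>\<close>.  In this form the letters induce operators on the closed span.
\<close>

lemma dilation_contractive:
  assumes \<psi>: "dilation T \<psi>"
  shows "norm (\<Sum>e\<in>A. c e *\<^sub>C \<psi> (prepend l e)) \<le> norm (\<Sum>e\<in>A. c e *\<^sub>C \<psi> e)"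
proof -
  define Y where "Y h = (\<Sum>e\<in>A. c e *\<^sub>C \<psi> (h e))" for h
  have adj: "cinner (Y (\<lambda>e. prepend l (h e))) (Y h') = cinner (Y h) (Y (\<lambda>e. prepend (star l) (h' e)))"
    for l h h'
    by (simp add: Y_def cinner_sum_left cinner_sum_right cinner_scaleC_left cinner_scaleC_right
        dilationD(3)[OF \<psi>])
  have both: "norm (Y (prepend Res)) \<le> norm (Y (\<lambda>e. e)) \<and> norm (Y (prepend l)) \<le> norm (Y (\<lambda>e. e))"
    if l: "l \<noteq> Res" for l
  proof -
    have "Y (\<lambda>e. prepend (star l) (prepend l e)) = Y (prepend Res) - Y (\<lambda>e. prepend Res (prepend Res e))"
      using l by (simp add: Y_def dilationD(5)[OF \<psi>] complex_vector.scale_right_diff_distrib sum_subtractf)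
    then have "cinner (Y (prepend l)) (Y (prepend l)) + cinner (Y (prepend Res)) (Y (prepend Res))
        = cinner (Y (\<lambda>e. e)) (Y (prepend Res))"
      using adj[of l "\<lambda>e. e" "prepend l"] adj[of Res "\<lambda>e. e" "prepend Res"]
      by (simp add: cinner_diff_right)
    then have "(norm (Y (prepend l)))\<^sup>2 + (norm (Y (prepend Res)))\<^sup>2 = inner (Y (\<lambda>e. e)) (Y (prepend Res))"
      by (simp add: inner_eq_Re_cinner power2_norm_eq_inner flip: plus_complex.sel)
    also have "\<dots> \<le> norm (Y (\<lambda>e. e)) * norm (Y (prepend Res))"
      by (rule norm_cauchy_schwarz)
    finally have le: "(norm (Y (prepend l)))\<^sup>2 + (norm (Y (prepend Res)))\<^sup>2 \<le> norm (Y (\<lambda>e. e)) * norm (Y (prepend Res))" .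
    then have "norm (Y (prepend Res)) * norm (Y (prepend Res)) \<le> norm (Y (\<lambda>e. e)) * norm (Y (prepend Res))"
      using zero_le_power2[of "norm (Y (prepend l))"] unfolding power2_eq_square by linarith
    then have R: "norm (Y (prepend Res)) \<le> norm (Y (\<lambda>e. e))"
      by (cases "Y (prepend Res) = 0") auto
    then have "norm (Y (\<lambda>e. e)) * norm (Y (prepend Res)) \<le> norm (Y (\<lambda>e. e)) * norm (Y (\<lambda>e. e))"
      by (intro mult_left_mono) auto
    with le have "(norm (Y (prepend l)))\<^sup>2 \<le> (norm (Y (\<lambda>e. e)))\<^sup>2"
      using zero_le_power2[of "norm (Y (prepend Res))"] unfolding power2_eq_square[of "norm (Y (\<lambda>e. e))"]
      by linarith
    with R show ?thesis by (simp add: power2_le_iff_abs_le)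
  qed
  show ?thesis
    using both[of l] both[of Fwd] unfolding Y_def by (cases "l = Res") auto
qed

lemma dilation_norm_le:
  assumes \<psi>: "dilation T \<psi>"
  shows "norm (\<psi> (f, w)) \<le> norm f"
proof (induction w)
  case Nil
  show ?case
  proof (cases "f \<in> Domain T")
    case True
    then have "cinner (\<psi> (f, [])) (\<psi> (f, [])) = cinner f f" by (intro dilationD(2)[OF \<psi>])
    then have "(norm (\<psi> (f, [])))\<^sup>2 = (norm f)\<^sup>2"
      unfolding cinner_self of_real_eq_iff .
    then show ?thesis by (simp add: power2_eq_iff_nonneg)
  qed (simp add: dilationD(1)[OF \<psi>])
next
  case (Cons l w)
  then show ?case
    using dilation_contractive[OF \<psi>, where A="{(f, w)}" and c="\<lambda>_. 1" and l=l] by (simp add: prepend_def scaleC_one)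
qed


section \<open>From normal extensions to dilations\<close>

text \<open>
  Von Neumann's construction: projecting \<open>(x, 0)\<close> onto the closed graph of \<open>N\<close> gives \<open>(u, a)\<close> with
  \<open>a = N u\<close> and \<open>x = u + N\<^sup>* a\<close>, so \<open>u = (I + N\<^sup>*N)\<^sup>-\<^sup>1 x\<close>.  Normality supplies the same decomposition with
  \<open>N\<close> and \<open>N\<^sup>*\<close> interchanged.  All the algebraic identities then follow from pairing elements of the
  graphs of \<open>N\<close> and \<open>N\<^sup>*\<close>; the last two applied to \<open>(R x, Z x)\<close> contain the commutation relation
  and \<open>Z\<^sup>*Z = R - R\<^sup>2\<close>.
\<close>

lemma normal_resolvent:
  fixes N :: "'k::chilbert_space operator"
  assumes K: "closed_csubspace K" and N: "normal_in K N"
  obtains op :: "letter \<Rightarrow> 'k \<Rightarrow> 'k" where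
    "\<And>l x. x \<in> K \<Longrightarrow> op l x \<in> K"
    "\<And>l x y. x \<in> K \<Longrightarrow> y \<in> K \<Longrightarrow> cinner (op l x) y = cinner x (op (star l) y)"
    "\<And>l x. x \<in> K \<Longrightarrow> op l (op Res x) = op Res (op l x)"
    "\<And>l x. x \<in> K \<Longrightarrow> l \<noteq> Res \<Longrightarrow> op (star l) (op l x) = op Res x - op Res (op Res x)"
    "\<And>x y. (x, y) \<in> N \<Longrightarrow> op Res y = op Fwd x"
    "\<And>x y. (x, y) \<in> N \<Longrightarrow> x = op Res x + op Bwd y"
proof -
  have sub: "csubspace K" using K by (simp add: closed_csubspace_def)
  have diffK: "x - y \<in> K" if "x \<in> K" "y \<in> K" for x y
    using that by (rule complex_vector.subspace_diff[OF sub])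
  have opN: "operator_in K N" and "closed N" and comm: "N O adjoint_in K N = adjoint_in K N O N"
    using N by (auto simp: normal_in_def densely_defined_in_def)
  have NK: "x \<in> K \<and> y \<in> K" if "(x, y) \<in> N" for x y
    using opN that by (auto simp: operator_in_def)
  have "csubspace N"
    using opN by (auto simp: operator_in_def complex_vector.subspace_def scaleC_prod_def zero_prod_def)
  with \<open>closed N\<close> have "closed_csubspace N" by (simp add: closed_csubspace_def)
  then obtain P where "bounded_clinear P" and PN: "\<And>p. P p \<in> N" and "\<And>p. p \<in> N \<Longrightarrow> P p = p"
    and orth: "\<And>p q. q \<in> N \<Longrightarrow> cinner q (p - P p) = 0"
    by (rule orthogonal_projection) (rule that, assumption+)
  have "\<exists>u a b. (u, a) \<in> N \<and> (a, x - u) \<in> adjoint_in K N \<and> (u, b) \<in> adjoint_in K N \<and> (b, x - u) \<in> N"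
    if "x \<in> K" for x
  proof -
    obtain u a where ua: "P (x, 0) = (u, a)" by (cases "P (x, 0)")
    then have uaN: "(u, a) \<in> N" using PN[of "(x, 0)"] by simp
    have "cinner q a = cinner p (x - u)" if "(p, q) \<in> N" for p q
      using orth[OF that, of "(x, 0)"] by (simp add: ua cinner_prod_def cinner_minus_right)
    then have adj: "(a, x - u) \<in> adjoint_in K N"
      using NK[OF uaN] diffK[OF that] by (auto simp: adjoint_in_def)
    with uaN have "(u, x - u) \<in> adjoint_in K N O N" using comm by blast
    with uaN adj show ?thesis by blast
  qed
  then obtain r a b where rab: "\<And>x. x \<in> K \<Longrightarrow> (r x, a x) \<in> N \<and> (a x, x - r x) \<in> adjoint_in K N \<and>
      (r x, b x) \<in> adjoint_in K N \<and> (b x, x - r x) \<in> N"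
    by metis
  define op where "op l = (case l of Res \<Rightarrow> r | Fwd \<Rightarrow> a | Bwd \<Rightarrow> b)" for l
  \<comment> \<open>The relation \<open>G l\<close> is \<open>N\<close> or its adjoint; indexing by letters lets one argument serve for both.\<close>
  define G where "G l = (if l = Fwd then N else adjoint_in K N)" for l
  have GK: "x \<in> K" "y \<in> K" if "(x, y) \<in> G l" for x y l
    using that NK[of x y] by (auto simp: G_def adjoint_in_def split: if_splits)
  have pair: "cinner y u = cinner x v" if "l \<noteq> Res" "(x, y) \<in> G l" "(u, v) \<in> G (star l)" for l x y u v
  proof (cases l)
    case Fwd
    with that show ?thesis by (auto simp: G_def adjoint_in_def)
  next
    case Bwd
    with that have "cinner v x = cinner u y" by (auto simp: G_def adjoint_in_def)
    then show ?thesis by (metis cinner_commute)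
  qed (use that in simp)
  have op: "(op Res x, op l x) \<in> G l" "(op l x, x - op Res x) \<in> G (star l)" if "x \<in> K" "l \<noteq> Res" for x l
    using rab[OF \<open>x \<in> K\<close>] \<open>l \<noteq> Res\<close> by (cases l; simp add: op_def G_def)+
  have opK: "op l x \<in> K" if "x \<in> K" for l x
    using op[OF that, of l] op[OF that, of Fwd] GK by (cases "l = Res") blast+
  have adj: "cinner (op l x) y = cinner x (op (star l) y)" if "x \<in> K" "y \<in> K" for l x y
  proof (cases "l = Res")
    case True
    have *: "cinner (op Res x) y = cinner (op Res x) (op Res y) + cinner (op Fwd x) (op Fwd y)"
      if "x \<in> K" "y \<in> K" for x y
      using pair[OF _ op(1)[OF that(1)] op(2)[OF that(2)], of Fwd] by (simp add: cinner_diff_right)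
    have "cinner (op Res x) y = cnj (cinner (op Res y) x)"
      unfolding *[OF that] *[OF that(2,1)] using cinner_commute by (metis complex_cnj_add)
    with True show ?thesis by (simp add: cinner_commute[of x "op Res y"])
  next
    case l: False
    then have sl: "star l \<noteq> Res" by simp
    have "cinner (op l x) (op Res y) = cinner (op Res x) (op (star l) y)"
      using pair[OF l op(1)[OF that(1) l] op(1)[OF that(2) sl]] .
    moreover have "cinner (x - op Res x) (op (star l) y) = cinner (op l x) (y - op Res y)"
      using pair[OF sl op(2)[OF that(1) l]] op(2)[OF that(2) sl] by simp
    ultimately show ?thesis by (simp add: cinner_diff_left cinner_diff_right)
  qed
  have eqI: "u = v" if "u \<in> K" "v \<in> K" "\<And>z. z \<in> K \<Longrightarrow> cinner u z = cinner v z" for u v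
    using that(3)[OF diffK[OF that(1,2)]] cinner_self_eq_0[of "u - v"] by (simp add: cinner_diff_left)
  have shift: "op Res y = op l x" if "l \<noteq> Res" "(x, y) \<in> G l" for l x y
  proof (rule eqI)
    fix z assume z: "z \<in> K"
    have "cinner (op Res y) z = cinner y (op Res z)" using adj[of y z Res] GK[OF that(2)] z by simp
    also have "\<dots> = cinner x (op (star l) z)"
      using that z by (intro pair[OF that] op(1)) auto
    also have "\<dots> = cinner (op l x) z" using adj[of x z l] GK[OF that(2)] z by simp
    finally show "cinner (op Res y) z = cinner (op l x) z" .
  qed (use opK GK[OF that(2)] in auto)
  have recover: "op (star l) y = x - op Res x" if "l \<noteq> Res" "(x, y) \<in> G l" for l x y
  proof (rule eqI)
    fix z assume z: "z \<in> K"
    have "cinner (op (star l) y) z = cinner y (op l z)" using adj[of y z "star l"] GK[OF that(2)] z by simp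
    also have "\<dots> = cinner x (z - op Res z)"
      using that z by (intro pair[OF that] op(2)) auto
    also have "\<dots> = cinner (x - op Res x) z"
      using adj[of x z Res] GK[OF that(2)] z by (simp add: cinner_diff_left cinner_diff_right)
    finally show "cinner (op (star l) y) z = cinner (x - op Res x) z" .
  qed (use opK GK[OF that(2)] diffK in auto)
  show thesis
  proof (rule that[of op])
    show "op l (op Res x) = op Res (op l x)" if "x \<in> K" for l x
      using shift[OF _ op(1)[OF that], of l] by (cases "l = Res") auto
    show "op (star l) (op l x) = op Res x - op Res (op Res x)" if "x \<in> K" "l \<noteq> Res" for l x
      using recover[OF that(2) op(1)[OF that]] .
    show "op Res y = op Fwd x" "x = op Res x + op Bwd y" if "(x, y) \<in> N" for x y
      using shift[of Fwd x y] recover[of Fwd x y] that by (auto simp: G_def)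
  qed (use opK adj in auto)
qed

lemma normal_extension_imp_dilation:
  fixes N :: "'k::chilbert_space operator" and T :: "'a::complex_inner operator"
  assumes K: "closed_csubspace K" and N: "normal_in K N" and H: "csubspace H"
    and T: "Domain T \<subseteq> H" "Range T \<subseteq> Domain T" and V: "isometric_embedding H K V"
    and ext: "\<And>x y. (x, y) \<in> T \<Longrightarrow> (V x, V y) \<in> N"
  obtains \<psi> :: "'a \<times> letter list \<Rightarrow> 'k" where "dilation T \<psi>"
proof -
  obtain op :: "letter \<Rightarrow> 'k \<Rightarrow> 'k" where op:
    "\<And>l x. x \<in> K \<Longrightarrow> op l x \<in> K"
    "\<And>l x y. x \<in> K \<Longrightarrow> y \<in> K \<Longrightarrow> cinner (op l x) y = cinner x (op (star l) y)"
    "\<And>l x. x \<in> K \<Longrightarrow> op l (op Res x) = op Res (op l x)"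
    "\<And>l x. x \<in> K \<Longrightarrow> l \<noteq> Res \<Longrightarrow> op (star l) (op l x) = op Res x - op Res (op Res x)"
    "\<And>x y. (x, y) \<in> N \<Longrightarrow> op Res y = op Fwd x"
    "\<And>x y. (x, y) \<in> N \<Longrightarrow> x = op Res x + op Bwd y"
    by (rule normal_resolvent[OF K N]) (rule that, assumption+)
  define \<psi> where "\<psi> e = (if fst e \<in> Domain T then foldr op (snd e) (V (fst e)) else 0)" for e
  have VK: "V f \<in> K" if "f \<in> Domain T" for f
    using that T(1) V by (auto simp: isometric_embedding_def)
  have foldK: "foldr op w (V f) \<in> K" if "f \<in> Domain T" for f w
    using VK[OF that] by (induction w) (auto intro: op(1))
  have dom: "f \<in> Domain T" "g \<in> Domain T" if "(f, g) \<in> T" for f g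
    using that T(2) by auto
  have iso: "cinner (V f) (V g) = cinner f g" if "f \<in> Domain T" "g \<in> Domain T" for f g
    using norm_preserving_imp_cinner_preserving[OF H, of V f g] that T(1) V
    by (auto simp: isometric_embedding_def)
  have "dilation T \<psi>"
    unfolding dilation_def
  proof (intro conjI allI ballI impI)
    show "cinner (\<psi> (prepend l d)) (\<psi> e) = cinner (\<psi> d) (\<psi> (prepend (star l) e))" for l d e
      by (simp add: \<psi>_def prepend_def op(2) foldK)
    show "\<psi> (prepend l (prepend Res e)) = \<psi> (prepend Res (prepend l e))" for l e
      using op(3)[of "foldr op (snd e) (V (fst e))" l] by (simp add: \<psi>_def prepend_def foldK)
    show "\<psi> (prepend (star l) (prepend l e)) = \<psi> (prepend Res e) - \<psi> (prepend Res (prepend Res e))"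
      if "l \<noteq> Res" for l e
      using op(4)[OF _ that, of "foldr op (snd e) (V (fst e))"] by (simp add: \<psi>_def prepend_def foldK)
    show "case p of (f, g) \<Rightarrow> \<psi> (g, [Res]) = \<psi> (f, [Fwd]) \<and> \<psi> (f, []) = \<psi> (f, [Res]) + \<psi> (g, [Bwd])"
      if "p \<in> T" for p
    proof (cases p)
      case (Pair f g)
      with that have "(f, g) \<in> T" by simp
      from dom[OF this] op(5,6)[OF ext[OF this]] show ?thesis by (simp add: Pair \<psi>_def)
    qed
  qed (simp_all add: \<psi>_def iso)
  then show thesis by (rule that)
qed


section \<open>Limits of dilations\<close>

text \<open>
  By Tychonoff's theorem the functions bounded by \<open>B\<close> form a compact set, so the image filter has
  a cluster point.  Convergence along a finer filter takes the place of a convergent subsequence.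
\<close>

lemma pointwise_cluster_point:
  fixes \<kappa> :: "'w \<Rightarrow> 'p \<Rightarrow> complex"
  assumes F: "F \<noteq> bot" and bound: "\<forall>\<^sub>F \<omega> in F. \<forall>p. cmod (\<kappa> \<omega> p) \<le> B p"
  obtains G k where "G \<noteq> bot" "G \<le> F" "\<And>p. ((\<lambda>\<omega>. \<kappa> \<omega> p) \<longlongrightarrow> k p) G"
proof -
  define U where "U = (\<Pi>\<^sub>E p\<in>UNIV. cball (0 :: complex) (B p))"
  have "compactin (product_topology (\<lambda>_. euclidean) UNIV) U"
    unfolding U_def compactin_PiE by simp
  then have "compact U" by (simp add: euclidean_product_topology)
  moreover have "filtermap \<kappa> F \<noteq> bot" using F by (simp add: filtermap_bot_iff)
  moreover have "eventually (\<lambda>f. f \<in> U) (filtermap \<kappa> F)"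
    using bound by (simp add: eventually_filtermap U_def PiE_iff)
  ultimately obtain k where k: "inf (nhds k) (filtermap \<kappa> F) \<noteq> bot"
    unfolding compact_filter by blast
  define G where "G = inf F (filtercomap \<kappa> (nhds k))"
  have "G \<noteq> bot"
  proof
    assume "G = bot"
    then have "eventually (\<lambda>_. False) G" by simp
    then obtain P R where P: "eventually P F" and R: "eventually R (nhds k)"
      and PR: "\<And>\<omega>. P \<omega> \<Longrightarrow> \<not> R (\<kappa> \<omega>)"
      unfolding G_def eventually_inf eventually_filtercomap by blast
    have "eventually (\<lambda>y. \<not> R y) (filtermap \<kappa> F)"
      unfolding eventually_filtermap using P by (rule eventually_mono) (rule PR)
    with R have "eventually (\<lambda>_. False) (inf (nhds k) (filtermap \<kappa> F))"
      unfolding eventually_inf by blast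
    with k show False by (simp add: trivial_limit_def)
  qed
  moreover have "G \<le> F" by (simp add: G_def)
  moreover have "((\<lambda>\<omega>. \<kappa> \<omega> p) \<longlongrightarrow> k p) G" for p
  proof -
    have "filtermap \<kappa> G \<le> nhds k"
      unfolding G_def using filtermap_mono[OF inf_le2] filtermap_filtercomap by (rule order_trans)
    then have "(\<kappa> \<longlongrightarrow> k) G" by (simp add: filterlim_def)
    moreover have "((\<lambda>f. f p) \<longlongrightarrow> k p) (nhds k)"
    proof (rule topological_tendstoI)
      fix S :: "complex set" assume S: "open S" "k p \<in> S"
      have "open ((\<lambda>f. f p) -` S)"
        using S(1) continuous_on_product_coordinates by (rule open_vimage)
      with S(2) show "\<forall>\<^sub>F f in nhds k. f p \<in> S"
        unfolding eventually_nhds by (intro exI[of _ "(\<lambda>f. f p) -` S"]) auto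
    qed
    ultimately show ?thesis by (rule filterlim_compose[rotated])
  qed
  ultimately show thesis by (rule that)
qed


text \<open>
  The kernels of inner products are uniformly bounded and therefore converge along a finer filter;
  the limit is positive definite and is represented by vectors \<open>\<phi>\<close>.  A linear relation between
  vectors passes to the limit because the norm of the difference of its sides is a polynomial in
  the inner products.
\<close>

lemma dilation_limit:
  fixes \<psi> :: "'w \<Rightarrow> 'a::complex_inner \<times> letter list \<Rightarrow> 'b::complex_inner"
    and \<iota> :: "'a \<times> letter list \<Rightarrow> 'i"
  assumes F: "F \<noteq> bot" and dil: "\<forall>\<^sub>F \<omega> in F. dilation (T \<omega>) (\<psi> \<omega>)"
    and sub: "\<forall>\<^sub>F \<omega> in F. T \<omega> \<subseteq> T0" and sup: "\<And>p. p \<in> T0 \<Longrightarrow> \<forall>\<^sub>F \<omega> in F. p \<in> T \<omega>"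
    and "inj \<iota>"
  obtains \<phi> :: "'a \<times> letter list \<Rightarrow> 'i ell2" where "dilation T0 \<phi>"
proof -
  have "\<forall>\<^sub>F \<omega> in F. \<forall>p. cmod (case p of (d, e) \<Rightarrow> cinner (\<psi> \<omega> d) (\<psi> \<omega> e)) \<le> (case p of (d, e) \<Rightarrow> 2 * norm (fst d) * norm (fst e))"
    using dil
  proof eventually_elim
    case (elim \<omega>)
    have "cmod (cinner (\<psi> \<omega> d) (\<psi> \<omega> e)) \<le> 2 * norm (fst d) * norm (fst e)" for d e
    proof -
      have "norm (\<psi> \<omega> d) \<le> norm (fst d)" "norm (\<psi> \<omega> e) \<le> norm (fst e)"
        using dilation_norm_le[OF elim] by (metis prod.collapse)+
      then have "2 * norm (\<psi> \<omega> d) * norm (\<psi> \<omega> e) \<le> 2 * norm (fst d) * norm (fst e)"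
        by (intro mult_mono) auto
      with cmod_cinner_le show ?thesis by (rule order_trans)
    qed
    then show ?case by auto
  qed
  then obtain G k where "G \<noteq> bot" "G \<le> F"
    and k: "\<And>p. ((\<lambda>\<omega>. case p of (d, e) \<Rightarrow> cinner (\<psi> \<omega> d) (\<psi> \<omega> e)) \<longlongrightarrow> k p) G"
    by (rule pointwise_cluster_point[OF F]) (rule that, assumption+)
  have lim_k: "((\<lambda>\<omega>. cinner (\<psi> \<omega> d) (\<psi> \<omega> e)) \<longlongrightarrow> k (d, e)) G" for d e
    using k[of "(d, e)"] by simp
  have evG: "eventually P G" if "eventually P F" for P
    using that \<open>G \<le> F\<close> by (rule filter_leD[rotated])
  obtain \<phi> :: "'a \<times> letter list \<Rightarrow> 'i ell2" where \<phi>: "\<And>d e. cinner (\<phi> d) (\<phi> e) = k (d, e)"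
  proof (rule Gram_representation[OF \<open>inj \<iota>\<close>])
    show "k (d, e) = cnj (k (e, d))" for d e
    proof (rule tendsto_unique[OF \<open>G \<noteq> bot\<close> lim_k])
      show "((\<lambda>\<omega>. cinner (\<psi> \<omega> d) (\<psi> \<omega> e)) \<longlongrightarrow> cnj (k (e, d))) G"
        using tendsto_cnj[OF lim_k[of e d]] by (simp flip: cinner_commute)
    qed
    show "0 \<le> Re (\<Sum>s\<in>A. \<Sum>t\<in>A. c s * cnj (c t) * k (s, t))" for A c
    proof (rule tendsto_lowerbound[OF _ _ \<open>G \<noteq> bot\<close>])
      show "((\<lambda>\<omega>. Re (\<Sum>s\<in>A. \<Sum>t\<in>A. c s * cnj (c t) * cinner (\<psi> \<omega> s) (\<psi> \<omega> t)))
          \<longlongrightarrow> Re (\<Sum>s\<in>A. \<Sum>t\<in>A. c s * cnj (c t) * k (s, t))) G"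
        by (intro tendsto_intros lim_k)
      show "\<forall>\<^sub>F \<omega> in G. 0 \<le> Re (\<Sum>s\<in>A. \<Sum>t\<in>A. c s * cnj (c t) * cinner (\<psi> \<omega> s) (\<psi> \<omega> t))"
        by (simp flip: cinner_combination add: cinner_self)
    qed
  qed (rule that)
  have lim: "((\<lambda>\<omega>. cinner (\<psi> \<omega> d) (\<psi> \<omega> e)) \<longlongrightarrow> cinner (\<phi> d) (\<phi> e)) G" for d e
    using lim_k by (simp add: \<phi>)
  have transfer_cinner: "cinner (\<phi> d) (\<phi> e) = z"
    if "\<forall>\<^sub>F \<omega> in F. cinner (\<psi> \<omega> d) (\<psi> \<omega> e) = z" for d e z
    using tendsto_unique[OF \<open>G \<noteq> bot\<close> lim tendsto_eventually[OF evG[OF that]]] .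
  have transfer_rel: "\<phi> d = \<phi> e + s *\<^sub>C \<phi> e'" if "\<forall>\<^sub>F \<omega> in F. \<psi> \<omega> d = \<psi> \<omega> e + s *\<^sub>C \<psi> \<omega> e'" for d e e' s
  proof -
    \<comment> \<open>The squared norm of \<open>u d - (u e + s u e')\<close> in terms of the Gram kernel \<open>g\<close> of \<open>u\<close>.\<close>
    define Q :: "((_ \<Rightarrow> _ \<Rightarrow> complex) \<Rightarrow> complex)" where
      "Q g = g d d - g d e - cnj s * g d e' - g e d + g e e + cnj s * g e e'
        - s * g e' d + s * g e' e + s * cnj s * g e' e'" for g
    have Q: "cinner (u d - (u e + s *\<^sub>C u e')) (u d - (u e + s *\<^sub>C u e')) = Q (\<lambda>x y. cinner (u x) (u y))"
      for u :: "_ \<Rightarrow> 'c::complex_inner"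
      by (simp add: Q_def cinner_diff_left cinner_diff_right cinner_add_left cinner_add_right
          cinner_scaleC_left cinner_scaleC_right algebra_simps)
    have "((\<lambda>\<omega>. Q (\<lambda>x y. cinner (\<psi> \<omega> x) (\<psi> \<omega> y))) \<longlongrightarrow> Q (\<lambda>x y. cinner (\<phi> x) (\<phi> y))) G"
      unfolding Q_def by (intro tendsto_intros lim)
    moreover have "\<forall>\<^sub>F \<omega> in G. Q (\<lambda>x y. cinner (\<psi> \<omega> x) (\<psi> \<omega> y)) = 0"
      using evG[OF that] by (rule eventually_mono) (simp flip: Q)
    ultimately have "Q (\<lambda>x y. cinner (\<phi> x) (\<phi> y)) = 0"
      by (rule tendsto_unique[OF \<open>G \<noteq> bot\<close> _ tendsto_eventually])
    then show ?thesis unfolding Q[symmetric] cinner_self_eq_0 by simp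
  qed
  have transfer_eq: "\<phi> d = \<phi> e" if "\<forall>\<^sub>F \<omega> in F. \<psi> \<omega> d = \<psi> \<omega> e" for d e
    using transfer_rel[of d e 0 e] that by simp
  have transfer_add: "\<phi> d = \<phi> e + \<phi> e'" if "\<forall>\<^sub>F \<omega> in F. \<psi> \<omega> d = \<psi> \<omega> e + \<psi> \<omega> e'" for d e e'
    using transfer_rel[of d e 1 e'] that by (simp add: scaleC_one)
  have transfer_diff: "\<phi> d = \<phi> e - \<phi> e'" if "\<forall>\<^sub>F \<omega> in F. \<psi> \<omega> d = \<psi> \<omega> e - \<psi> \<omega> e'" for d e e'
    using transfer_rel[of d e "-1" e'] that by (simp add: scaleC_one)
  have dom: "\<forall>\<^sub>F \<omega> in F. f \<in> Domain (T \<omega>)" if f: "f \<in> Domain T0" for f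
  proof -
    obtain g where "(f, g) \<in> T0" using f by blast
    from sup[OF this] show ?thesis by (rule eventually_mono) blast
  qed
  have "dilation T0 \<phi>"
    unfolding dilation_def
  proof (intro conjI allI ballI impI)
    fix f w assume f: "f \<notin> Domain T0"
    \<comment> \<open>The equation \<open>x = x + x\<close> expresses \<open>x = 0\<close> as a relation of the transferable form.\<close>
    have "\<forall>\<^sub>F \<omega> in F. \<psi> \<omega> (f, w) = \<psi> \<omega> (f, w) + \<psi> \<omega> (f, w)"
      using dil sub by eventually_elim (use f dilationD(1) in force)
    from transfer_add[OF this] show "\<phi> (f, w) = 0" by simp
  next
    fix f g assume fg: "f \<in> Domain T0" "g \<in> Domain T0"
    show "cinner (\<phi> (f, [])) (\<phi> (g, [])) = cinner f g"
      using dil dom[OF fg(1)] dom[OF fg(2)]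
      by (intro transfer_cinner, eventually_elim) (rule dilationD(2))
  next
    fix l d e
    have "((\<lambda>\<omega>. cinner (\<psi> \<omega> (prepend l d)) (\<psi> \<omega> e)) \<longlongrightarrow> cinner (\<phi> d) (\<phi> (prepend (star l) e))) G"
      using evG[OF dil] by (intro Lim_transform_eventually[OF lim]) (auto elim!: eventually_mono simp: dilationD(3))
    with lim show "cinner (\<phi> (prepend l d)) (\<phi> e) = cinner (\<phi> d) (\<phi> (prepend (star l) e))"
      by (rule tendsto_unique[OF \<open>G \<noteq> bot\<close>])
  next
    fix l e show "\<phi> (prepend l (prepend Res e)) = \<phi> (prepend Res (prepend l e))"
      using dil by (intro transfer_eq, eventually_elim) (rule dilationD(4))
  next
    fix l e assume l: "l \<noteq> Res"
    show "\<phi> (prepend (star l) (prepend l e)) = \<phi> (prepend Res e) - \<phi> (prepend Res (prepend Res e))"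
      using dil by (intro transfer_diff, eventually_elim) (rule dilationD(5)[OF _ l])
  next
    fix p assume p: "p \<in> T0"
    obtain f g where fg: "p = (f, g)" by (cases p)
    have "\<phi> (g, [Res]) = \<phi> (f, [Fwd])"
      using dil sup[OF p] unfolding fg by (intro transfer_eq, eventually_elim) (rule dilationD(6))
    moreover have "\<phi> (f, []) = \<phi> (f, [Res]) + \<phi> (g, [Bwd])"
      using dil sup[OF p] unfolding fg by (intro transfer_add, eventually_elim) (rule dilationD(7))
    ultimately show "case p of (f, g) \<Rightarrow> \<phi> (g, [Res]) = \<phi> (f, [Fwd]) \<and> \<phi> (f, []) = \<phi> (f, [Res]) + \<phi> (g, [Bwd])"
      by (simp add: fg)
  qed
  then show thesis by (rule that)
qed


section \<open>From dilations to normal extensions\<close>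

text \<open>
  The operator is \<open>N = R\<^sup>-\<^sup>1 Z\<close> with graph \<open>R y = Z x\<close>, which is closed.  With \<open>M = R\<^sup>-\<^sup>1 Z\<^sup>*\<close>, every
  \<open>(x, y)\<close> in the graph of \<open>N\<close> satisfies \<open>x = R x + Z\<^sup>* y\<close>, since both sides have the same image under the
  injective \<open>R\<close>; the same holds with \<open>N\<close>, \<open>M\<close> and \<open>Z\<close>, \<open>Z\<^sup>*\<close> interchanged.  Pairing these identities
  gives \<open>M = N\<^sup>*\<close>.  They also show that \<open>MN\<close> and \<open>NM\<close> both have the graph \<open>x = R (x + z)\<close>, whence
  normality.  The domain contains the range of \<open>R\<close>, dense because \<open>R\<close> is self-adjoint and injective.
\<close>

lemma normal_of_resolvent:
  fixes op :: "letter \<Rightarrow> 'b::chilbert_space \<Rightarrow> 'b"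
  assumes K: "closed_csubspace K" and op: "\<And>l. bounded_clinear (op l)"
    and opK: "\<And>l x. x \<in> K \<Longrightarrow> op l x \<in> K"
    and adj: "\<And>l x y. x \<in> K \<Longrightarrow> y \<in> K \<Longrightarrow> cinner (op l x) y = cinner x (op (star l) y)"
    and comm: "\<And>l x. x \<in> K \<Longrightarrow> op l (op Res x) = op Res (op l x)"
    and square: "\<And>l x. x \<in> K \<Longrightarrow> l \<noteq> Res \<Longrightarrow> op (star l) (op l x) = op Res x - op Res (op Res x)"
    and inj: "\<And>x. x \<in> K \<Longrightarrow> op Res x = 0 \<Longrightarrow> x = 0"
  shows "normal_in K {(x, y). x \<in> K \<and> y \<in> K \<and> op Res y = op Fwd x}"
proof -
  have sub: "csubspace K" and "closed K" using K by (simp_all add: closed_csubspace_def)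
  note K_intros = complex_vector.subspace_0[OF sub] complex_vector.subspace_add[OF sub]
    complex_vector.subspace_diff[OF sub] complex_vector.subspace_scale[OF sub] opK
  note lin = bounded_clinear_simps[OF op]
  define G where "G l = {(x, y). x \<in> K \<and> y \<in> K \<and> op Res y = op l x}" for l
  have inj2: "x = y" if "x \<in> K" "y \<in> K" "op Res x = op Res y" for x y
    using inj[of "x - y"] that by (simp add: lin K_intros)
  have recover: "x = op Res x + op (star l) y" if "l \<noteq> Res" "(x, y) \<in> G l" for l x y
  proof (rule inj2)
    have "op Res (op (star l) y) = op (star l) (op l x)"
      using that(2) comm[of y "star l"] by (simp add: G_def)
    then show "op Res x = op Res (op Res x + op (star l) y)"
      using that square[of x l] by (simp add: lin G_def)
  qed (use that(2) in \<open>auto simp: G_def intro!: K_intros\<close>)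
  have range: "(op Res z, op l z) \<in> G l" if "z \<in> K" for l z
    using that comm[of z l] by (simp add: G_def opK)
  have adjoint: "adjoint_in K (G l) = G (star l)" if l: "l \<noteq> Res" for l
  proof (intro set_eqI iffI; clarify)
    fix u v assume uv: "(u, v) \<in> adjoint_in K (G l)"
    then have K': "u \<in> K" "v \<in> K" by (auto simp: adjoint_in_def)
    have "cinner w (op Res v - op (star l) u) = 0" if w: "w \<in> K" for w
    proof -
      have "cinner (op l w) u = cinner (op Res w) v"
        using uv range[OF w, of l] by (auto simp: adjoint_in_def)
      then show ?thesis
        using adj[OF w K'(1), of l] adj[OF w K'(2), of Res] by (simp add: cinner_diff_right)
    qed
    from this[of "op Res v - op (star l) u"] show "(u, v) \<in> G (star l)"
      using K' by (simp add: G_def cinner_self_eq_0 K_intros)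
  next
    fix u v assume uv: "(u, v) \<in> G (star l)"
    have "cinner y u = cinner x v" if xy: "(x, y) \<in> G l" for x y
    proof -
      have K': "x \<in> K" "y \<in> K" "u \<in> K" "v \<in> K" using uv xy by (auto simp: G_def)
      have u: "u = op Res u + op l v" using recover[OF _ uv] l by simp
      have "cinner y u = cinner y (op Res u) + cinner y (op l v)"
        by (subst u) (rule cinner_add_right)
      also have "\<dots> = cinner (op Res y) u + cinner (op (star l) y) v"
        using adj[of y u Res] adj[of y v "star l"] K' by simp
      also have "op Res y = op l x" using xy by (simp add: G_def)
      also have "op (star l) y = x - op Res x" using recover[OF l xy] by (simp add: algebra_simps)
      also have "cinner (op l x) u + cinner (x - op Res x) v = cinner x (op (star l) u) + cinner x v - cinner x (op Res v)"
        using adj[of x u l] adj[of x v Res] K' by (simp add: cinner_diff_left)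
      also have "\<dots> = cinner x v" using uv by (simp add: G_def)
      finally show ?thesis .
    qed
    with uv show "(u, v) \<in> adjoint_in K (G l)" by (auto simp: adjoint_in_def G_def)
  qed
  have composition: "G l O G (star l) = {(x, z). x \<in> K \<and> z \<in> K \<and> x = op Res (x + z)}"
    if l: "l \<noteq> Res" for l
  proof (intro set_eqI iffI; clarify)
    fix x y z assume xy: "(x, y) \<in> G l" and yz: "(y, z) \<in> G (star l)"
    have "x = op Res x + op Res z" using recover[OF l xy] yz by (simp add: G_def)
    with xy yz show "x \<in> K \<and> z \<in> K \<and> x = op Res (x + z)" by (simp add: G_def lin)
  next
    fix x z assume xz: "x \<in> K" "z \<in> K" "x = op Res (x + z)"
    define y where "y = op l (x + z)"
    have K': "x + z \<in> K" "y \<in> K" using xz by (simp_all add: y_def K_intros)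
    have "(x, y) \<in> G l" using range[OF K'(1), of l] xz(3) by (simp add: y_def)
    moreover have "op (star l) y = x - op Res x"
      unfolding y_def using square[OF K'(1) l] xz(3) by simp
    moreover have "op Res z = x - op Res x"
      using xz(3) lin(1)[of Res x z] by (metis add_diff_cancel_left')
    ultimately show "(x, z) \<in> G l O G (star l)" using K' xz by (auto simp: G_def)
  qed
  have G0: "csubspace (G Fwd)"
    unfolding complex_vector.subspace_def G_def
    by (auto simp: zero_prod_def scaleC_Pair lin intro!: K_intros)
  have "operator_in K (G Fwd)"
    unfolding operator_in_def
  proof (intro conjI allI impI)
    show "single_valued (G Fwd)" by (auto simp: single_valued_def G_def intro: inj2)
    show "(0, 0) \<in> G Fwd" using complex_vector.subspace_0[OF G0] by (simp add: zero_prod_def)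
    show "(x + x', y + y') \<in> G Fwd" if "(x, y) \<in> G Fwd" "(x', y') \<in> G Fwd" for x y x' y'
      using complex_vector.subspace_add[OF G0 that] by simp
    show "(c *\<^sub>C x, c *\<^sub>C y) \<in> G Fwd" if "(x, y) \<in> G Fwd" for c x y
      using complex_vector.subspace_scale[OF G0 that, of c] by (simp add: scaleC_Pair)
  qed (auto simp: G_def)
  moreover have "K \<subseteq> closure (Domain (G Fwd))"
  proof
    fix y assume y: "y \<in> K"
    have subK: "Domain (G Fwd) \<subseteq> K" by (auto simp: G_def)
    have "csubspace (Domain (G Fwd))"
      unfolding complex_vector.subspace_def
    proof (intro conjI ballI allI)
      show "0 \<in> Domain (G Fwd)"
        using complex_vector.subspace_0[OF G0] by (auto simp: zero_prod_def)
      show "x + y \<in> Domain (G Fwd)" if x: "x \<in> Domain (G Fwd)" and y: "y \<in> Domain (G Fwd)" for x y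
      proof -
        obtain u v where "(x, u) \<in> G Fwd" "(y, v) \<in> G Fwd" using x y by auto
        from complex_vector.subspace_add[OF G0 this] show ?thesis by auto
      qed
      show "c *\<^sub>C x \<in> Domain (G Fwd)" if x: "x \<in> Domain (G Fwd)" for c x
      proof -
        obtain u where "(x, u) \<in> G Fwd" using x by auto
        from complex_vector.subspace_scale[OF G0 this, of c] show ?thesis by (auto simp: scaleC_Pair)
      qed
    qed
    then have M: "closed_csubspace (closure (Domain (G Fwd)))"
      by (simp add: closed_csubspace_def csubspace_closure)
    obtain P where "bounded_clinear P" and P: "\<And>x. P x \<in> closure (Domain (G Fwd))"
      and "\<And>x. x \<in> closure (Domain (G Fwd)) \<Longrightarrow> P x = x"
      and orth: "\<And>x m. m \<in> closure (Domain (G Fwd)) \<Longrightarrow> cinner m (x - P x) = 0"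
      by (rule orthogonal_projection[OF M]) (rule that, assumption+)
    have d: "y - P y \<in> K"
    proof -
      have "P y \<in> K" using P[of y] closure_minimal[OF subK \<open>closed K\<close>] by (rule rev_subsetD)
      with y show ?thesis by (rule complex_vector.subspace_diff[OF sub])
    qed
    have "op Res (op Res (y - P y)) \<in> Domain (G Fwd)"
      using range[OF opK[OF d, of Res], of Fwd] by (rule DomainI)
    then have "cinner (op Res (op Res (y - P y))) (y - P y) = 0"
      by (intro orth rev_subsetD[OF _ closure_subset])
    then have "cinner (op Res (y - P y)) (op Res (y - P y)) = 0"
      using adj[OF opK[OF d] d, of Res] by simp
    then have "y - P y = 0" using inj[OF d] by (simp add: cinner_self_eq_0)
    with P[of y] show "y \<in> closure (Domain (G Fwd))" by simp
  qed
  ultimately have "densely_defined_in K (G Fwd)"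
    by (auto simp: densely_defined_in_def dense_in_def operator_in_def)
  moreover have "closed (G Fwd)"
  proof -
    have "G Fwd = K \<times> K \<inter> {p. op Res (snd p) = op Fwd (fst p)}" by (auto simp: G_def)
    moreover have "bounded_linear (\<lambda>p. op Res (snd p))" "bounded_linear (\<lambda>p. op Fwd (fst p))"
      using op by (auto simp: bounded_clinear_def intro: bounded_linear_compose bounded_linear_fst bounded_linear_snd)
    ultimately show ?thesis
      using \<open>closed K\<close> by (auto intro!: closed_Int closed_Times closed_Collect_eq linear_continuous_on)
  qed
  moreover have "G Fwd O adjoint_in K (G Fwd) = adjoint_in K (G Fwd) O G Fwd"
    using composition[of Fwd] composition[of Bwd] adjoint[of Fwd] by simp
  ultimately show ?thesis by (simp add: normal_in_def G_def)
qed


text \<open>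
  By contractivity the letters induce bounded operators on the closed span \<open>K\<close> of the dilation, and
  the defining relations extend from the generators to \<open>K\<close>.  The point is the injectivity of the
  resolvent \<open>R\<close> on \<open>K\<close>: from \<open>R x = 0\<close> follows \<open>\<parallel>Z x\<parallel>\<^sup>2 = \<langle>x, R x - R\<^sup>2 x\<rangle> = 0\<close> and likewise \<open>Z\<^sup>* x = 0\<close>, so
  \<open>x\<close> is orthogonal to all vectors with a nonempty word, and through
  \<open>\<phi>(f, []) = \<phi>(f, R) + \<phi>(T f, Z\<^sup>*)\<close> to the others.
\<close>

lemma dilation_imp_normal_extension:
  fixes \<phi> :: "'a::chilbert_space \<times> letter list \<Rightarrow> 'b::chilbert_space"
  assumes \<phi>: "dilation T \<phi>" and inv: "Range T \<subseteq> Domain T" and dense: "closure (Domain T) = UNIV"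
  obtains K :: "'b set" and V N where
    "closed_csubspace K" "isometric_embedding UNIV K V" "bounded_clinear V"
    "normal_in K N" "\<And>x y. (x, y) \<in> T \<Longrightarrow> (V x, V y) \<in> N"
proof -
  define K where "K = closed_cspan (range \<phi>)"
  have K: "closed_csubspace K" unfolding K_def by (rule closed_csubspace_closed_cspan)
  have \<phi>K: "\<phi> e \<in> K" for e unfolding K_def using closed_cspan_superset[of "range \<phi>"] by auto
  have "\<exists>f. bounded_clinear f \<and> (\<forall>e. f (\<phi> e) = \<phi> (prepend l e))" for l
  proof -
    obtain f where "bounded_clinear f" "\<And>e. f (\<phi> e) = \<phi> (prepend l e)"
      using dilation_contractive[OF \<phi>] by (rule bounded_clinear_from_generators) (rule that, assumption+)
    then show ?thesis by blast
  qed
  then obtain op where op: "\<And>l. bounded_clinear (op l)" and op_\<phi>: "\<And>l e. op l (\<phi> e) = \<phi> (prepend l e)"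
    by metis
  have opK: "op l x \<in> K" if "x \<in> K" for l x
    using that[unfolded K_def] op K by (rule maps_closed_cspan) (auto simp: op_\<phi> \<phi>K)
  have eq: "f x = g x" if "x \<in> K" "bounded_clinear f" "bounded_clinear g" "\<And>e. f (\<phi> e) = g (\<phi> e)"
    for x and f g :: "'b \<Rightarrow> 'd::complex_inner"
    using that by (intro equal_on_closed_cspan[of x "range \<phi>" f g]) (auto simp: K_def)
  have adj: "cinner (op l x) y = cinner x (op (star l) y)" if xy: "x \<in> K" "y \<in> K" for l x y
  proof -
    have *: "cinner (op l x) (\<phi> e) = cinner x (op (star l) (\<phi> e))" for e
      by (rule eq[OF xy(1) bounded_clinear_compose[OF bounded_clinear_cinner_left op] bounded_clinear_cinner_left])
        (simp add: op_\<phi> dilationD(3)[OF \<phi>])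
    have "cinner y (op l x) = cinner (op (star l) y) x"
    proof (rule eq[OF xy(2) bounded_clinear_cinner_left bounded_clinear_compose[OF bounded_clinear_cinner_left op]])
      show "cinner (\<phi> e) (op l x) = cinner (op (star l) (\<phi> e)) x" for e
        by (subst (1 2) cinner_commute) (simp only: *)
    qed
    then show ?thesis by (subst (1 2) cinner_commute) (simp only:)
  qed
  have comm: "op l (op Res x) = op Res (op l x)" if "x \<in> K" for l x
    by (rule eq[OF that]) (simp_all add: bounded_clinear_compose op op_\<phi> dilationD(4)[OF \<phi>])
  have square: "op (star l) (op l x) = op Res x - op Res (op Res x)" if "x \<in> K" "l \<noteq> Res" for l x
    by (rule eq[OF that(1)])
      (simp_all add: bounded_clinear_compose bounded_clinear_diff op op_\<phi> dilationD(5)[OF \<phi> that(2)])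
  have inj: "x = 0" if x: "x \<in> K" and Rx: "op Res x = 0" for x
  proof -
    have zero: "op l x = 0" for l
    proof (cases "l = Res")
      case False
      have "cinner (op l x) (op l x) = cinner x (op (star l) (op l x))" by (rule adj[OF x opK[OF x]])
      also have "\<dots> = 0"
        using square[OF x False] by (simp add: Rx bounded_clinear_simps[OF op])
      finally show ?thesis by (simp add: cinner_self_eq_0)
    qed (use Rx in simp)
    have perp: "cinner (\<phi> (f, l # w)) x = 0" for f l w
      using adj[OF \<phi>K[of "(f, w)"] x, of l] by (simp add: op_\<phi> prepend_def zero)
    have "cinner (\<phi> (f, w)) x = 0" for f w
    proof (cases "w = [] \<and> f \<in> Domain T")
      case True
      then obtain g where "(f, g) \<in> T" by blast
      from dilationD(7)[OF \<phi> this] True show ?thesis by (simp add: cinner_add_left perp)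
    next
      case False
      then show ?thesis using perp dilationD(1)[OF \<phi>, of f w] by (cases w) auto
    qed
    then have "cinner (\<phi> e) x = cinner (\<phi> e) 0" for e by (cases e) simp
    then have "cinner x x = cinner x 0"
      by (rule eq[OF x bounded_clinear_cinner_left bounded_clinear_cinner_left])
    then show ?thesis by (simp add: cinner_self_eq_0)
  qed
  define N where "N = {(x, y). x \<in> K \<and> y \<in> K \<and> op Res y = op Fwd x}"
  have N: "normal_in K N"
    unfolding N_def by (rule normal_of_resolvent[OF K op opK adj comm square inj])
  define p where "p f = (if f \<in> Domain T then f else 0)" for f
  define q where "q f = \<phi> (f, [])" for f
  have qp: "cinner (q f) (q g) = cinner (p f) (p g)" for f g
    using dilationD(1)[OF \<phi>] dilationD(2)[OF \<phi>] by (simp add: p_def q_def)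
  have "norm (\<Sum>f\<in>A. c f *\<^sub>C q f) \<le> norm (\<Sum>f\<in>A. c f *\<^sub>C p f)" for A c
  proof -
    have "cinner (\<Sum>f\<in>A. c f *\<^sub>C q f) (\<Sum>f\<in>A. c f *\<^sub>C q f) = cinner (\<Sum>f\<in>A. c f *\<^sub>C p f) (\<Sum>f\<in>A. c f *\<^sub>C p f)"
      by (simp add: cinner_combination qp)
    then show ?thesis by (simp only: cinner_self of_real_eq_iff) (simp add: power2_eq_iff_nonneg)
  qed
  then obtain V where V: "bounded_clinear V" and Vp: "\<And>f. V (p f) = q f"
    by (rule bounded_clinear_from_generators) (rule that, assumption+)
  have V\<phi>: "V f = \<phi> (f, [])" if "f \<in> Domain T" for f
    using Vp[of f] that by (simp add: p_def q_def)
  have everywhere: "x \<in> M" if "closed M" "\<And>f. f \<in> Domain T \<Longrightarrow> f \<in> M" for x and M :: "'a set"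
  proof -
    have "Domain T \<subseteq> M" using that(2) by auto
    from closure_minimal[OF this that(1)] show ?thesis by (simp add: dense subset_iff)
  qed
  have "x \<in> V -` K" for x
  proof (rule everywhere)
    show "closed (V -` K)"
      using K V by (intro continuous_closed_vimage)
        (auto simp: closed_csubspace_def bounded_clinear_def linear_continuous_at)
  qed (simp add: V\<phi> \<phi>K)
  moreover have "x \<in> {x. norm (V x) = norm x}" for x
  proof (rule everywhere)
    show "closed {x. norm (V x) = norm x}"
      by (intro closed_Collect_eq continuous_on_norm continuous_on_id bounded_clinear_continuous[OF V])
    fix f assume f: "f \<in> Domain T"
    have "norm (V f) = norm f"
      using dilationD(2)[OF \<phi> f f] V\<phi>[OF f] by (simp only: cinner_self of_real_eq_iff) (simp add: power2_eq_iff_nonneg)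
    then show "f \<in> {x. norm (V x) = norm x}" by simp
  qed
  ultimately have iso: "isometric_embedding UNIV K V"
    by (auto simp: isometric_embedding_def bounded_clinear_simps[OF V])
  have "(V x, V y) \<in> N" if xy: "(x, y) \<in> T" for x y
  proof -
    have "x \<in> Domain T" "y \<in> Domain T" using xy inv by auto
    then show ?thesis
      using dilationD(6)[OF \<phi> xy] by (simp add: N_def V\<phi> \<phi>K op_\<phi> prepend_def)
  qed
  with K iso V N show thesis by (rule that)
qed


section \<open>Orbits and cores\<close>

text \<open>
  A vector \<open>S\<^sup>n x\<close> of the orbit lies in the domain of \<open>S\<close> because \<open>x\<close> lies in that of \<open>S\<^sup>n\<^sup>+\<^sup>1\<close>, and \<open>S\<close> takes
  it to the next vector of the orbit; linearity of \<open>S\<close> does the rest.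
\<close>

lemma orbit_span_invariant:
  assumes S: "operator_in UNIV S" and X: "X \<subseteq> D_infinity S" and f: "f \<in> orbit_span S X"
  shows "\<exists>g\<in>orbit_span S X. (f, g) \<in> S"
proof -
  define M where "M = {f. \<exists>g\<in>orbit_span S X. (f, g) \<in> S}"
  have add: "(x + x', y + y') \<in> S" if "(x, y) \<in> S" "(x', y') \<in> S" for x y x' y'
    using S that unfolding operator_in_def by simp
  have scale: "(c *\<^sub>C x, c *\<^sub>C y) \<in> S" if "(x, y) \<in> S" for c x y
    using S that unfolding operator_in_def by simp
  have zero: "(0, 0) \<in> S" using S by (simp add: operator_in_def)
  have orbit: "csubspace (orbit_span S X)"
    unfolding orbit_span_def by (rule complex_vector.subspace_span)
  have "single_valued (S ^^ n)" for n
    using S by (induction n) (auto simp: operator_in_def intro: single_valued_relcomp)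
  note sv = this
  have M: "csubspace M"
    unfolding complex_vector.subspace_def
  proof (intro conjI ballI allI)
    show "0 \<in> M" using zero complex_vector.subspace_0[OF orbit] by (auto simp: M_def)
    show "x + x' \<in> M" if "x \<in> M" "x' \<in> M" for x x'
      using that add complex_vector.subspace_add[OF orbit] unfolding M_def by fast
    show "c *\<^sub>C x \<in> M" if "x \<in> M" for c x
      using that scale complex_vector.subspace_scale[OF orbit] unfolding M_def by fast
  qed
  have "(\<Union>n. (S ^^ n) `` X) \<subseteq> M"
  proof clarify
    fix n x y assume x: "x \<in> X" and xy: "(x, y) \<in> S ^^ n"
    have "x \<in> Domain (S ^^ Suc n)" using x X unfolding D_infinity_def by blast
    then obtain y' z where z: "(x, z) \<in> S ^^ Suc n" and y': "(x, y') \<in> S ^^ n" "(y', z) \<in> S" by auto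
    have "y' = y" using sv xy y'(1) by (meson single_valuedD)
    have "z \<in> orbit_span S X"
      unfolding orbit_span_def using x z by (intro complex_vector.span_base) blast
    with y'(2) \<open>y' = y\<close> show "y \<in> M" unfolding M_def by blast
  qed
  then have "orbit_span S X \<subseteq> M"
    unfolding orbit_span_def using M by (rule complex_vector.span_minimal)
  with f show ?thesis by (auto simp: M_def)
qed

lemma orbit_span_mono: "X \<subseteq> Y \<Longrightarrow> orbit_span S X \<subseteq> orbit_span S Y"
  unfolding orbit_span_def by (intro complex_vector.span_mono) blast

lemma orbit_span_directed_union:
  assumes dir: "upward_directed \<Omega> X" and "\<Omega> \<noteq> {}"
    and f: "f \<in> orbit_span S (\<Union>\<omega>\<in>\<Omega>. X \<omega>)"
  obtains \<omega> where "\<omega> \<in> \<Omega>" "f \<in> orbit_span S (X \<omega>)"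
proof -
  let ?F = "\<lambda>\<omega>. orbit_span S (X \<omega>)"
  have sub: "csubspace (?F \<omega>)" for \<omega>
    unfolding orbit_span_def by (rule complex_vector.subspace_span)
  have "csubspace (\<Union>\<omega>\<in>\<Omega>. ?F \<omega>)"
    unfolding complex_vector.subspace_def
  proof (intro conjI ballI allI)
    show "0 \<in> (\<Union>\<omega>\<in>\<Omega>. ?F \<omega>)" using \<open>\<Omega> \<noteq> {}\<close> complex_vector.subspace_0[OF sub] by blast
  next
    fix x y assume "x \<in> (\<Union>\<omega>\<in>\<Omega>. ?F \<omega>)" "y \<in> (\<Union>\<omega>\<in>\<Omega>. ?F \<omega>)"
    then obtain \<omega>1 \<omega>2 where 1: "\<omega>1 \<in> \<Omega>" "x \<in> ?F \<omega>1" and 2: "\<omega>2 \<in> \<Omega>" "y \<in> ?F \<omega>2" by blast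
    then obtain \<omega> where \<omega>: "\<omega> \<in> \<Omega>" "X \<omega>1 \<union> X \<omega>2 \<subseteq> X \<omega>"
      using dir unfolding upward_directed_def by blast
    then have "x \<in> ?F \<omega>" "y \<in> ?F \<omega>"
      using 1 2 orbit_span_mono[of "X \<omega>1" "X \<omega>" S] orbit_span_mono[of "X \<omega>2" "X \<omega>" S] by auto
    then have "x + y \<in> ?F \<omega>" by (rule complex_vector.subspace_add[OF sub])
    with \<omega> show "x + y \<in> (\<Union>\<omega>\<in>\<Omega>. ?F \<omega>)" by blast
  next
    fix c x assume "x \<in> (\<Union>\<omega>\<in>\<Omega>. ?F \<omega>)"
    then show "c *\<^sub>C x \<in> (\<Union>\<omega>\<in>\<Omega>. ?F \<omega>)" using complex_vector.subspace_scale[OF sub] by blast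
  qed
  moreover have "(\<Union>n. (S ^^ n) `` (\<Union>\<omega>\<in>\<Omega>. X \<omega>)) \<subseteq> (\<Union>\<omega>\<in>\<Omega>. ?F \<omega>)"
  proof clarify
    fix n x y \<omega> assume "\<omega> \<in> \<Omega>" "x \<in> X \<omega>" "(x, y) \<in> S ^^ n"
    moreover from this have "y \<in> ?F \<omega>"
      unfolding orbit_span_def by (intro complex_vector.span_base) blast
    ultimately show "y \<in> (\<Union>\<omega>\<in>\<Omega>. ?F \<omega>)" by blast
  qed
  ultimately have "orbit_span S (\<Union>\<omega>\<in>\<Omega>. X \<omega>) \<subseteq> (\<Union>\<omega>\<in>\<Omega>. ?F \<omega>)"
    unfolding orbit_span_def[of S "\<Union>\<omega>\<in>\<Omega>. X \<omega>"] by (intro complex_vector.span_minimal)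
  with f that show thesis by blast
qed

lemma restriction_to_orbit:
  assumes S: "operator_in UNIV S" and X: "X \<subseteq> D_infinity S"
  shows "Domain (op_restrict S (orbit_span S X)) = orbit_span S X"
    and "Range (op_restrict S (orbit_span S X)) \<subseteq> orbit_span S X"
proof -
  have inv: "\<exists>g\<in>orbit_span S X. (f, g) \<in> S" if "f \<in> orbit_span S X" for f
    using orbit_span_invariant[OF S X that] .
  show "Domain (op_restrict S (orbit_span S X)) = orbit_span S X"
    using inv unfolding op_restrict_def by fast
  have "y \<in> orbit_span S X" if "x \<in> orbit_span S X" "(x, y) \<in> S" for x y
    using inv[OF that(1)] that(2) S unfolding operator_in_def single_valued_def by blast
  then show "Range (op_restrict S (orbit_span S X)) \<subseteq> orbit_span S X"
    unfolding op_restrict_def by auto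
qed

text \<open>
  The index set carries no order of its own; the family is ordered by inclusion of its members.
\<close>

definition tail_filter :: "'w set \<Rightarrow> ('w \<Rightarrow> 'a set) \<Rightarrow> 'w filter" where
  "tail_filter \<Omega> X = (INF \<omega>\<in>\<Omega>. principal {\<omega>' \<in> \<Omega>. X \<omega> \<subseteq> X \<omega>'})"

lemma eventually_tail_filter:
  assumes "upward_directed \<Omega> X" "\<Omega> \<noteq> {}"
  shows "eventually P (tail_filter \<Omega> X) \<longleftrightarrow> (\<exists>\<omega>\<in>\<Omega>. \<forall>\<omega>'\<in>\<Omega>. X \<omega> \<subseteq> X \<omega>' \<longrightarrow> P \<omega>')"
proof -
  define Q where "Q \<omega> = principal {\<omega>' \<in> \<Omega>. X \<omega> \<subseteq> X \<omega>'}" for \<omega>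
  have "\<exists>\<omega>\<in>\<Omega>. Q \<omega> \<le> inf (Q \<omega>1) (Q \<omega>2)" if \<omega>: "\<omega>1 \<in> \<Omega>" "\<omega>2 \<in> \<Omega>" for \<omega>1 \<omega>2
  proof -
    obtain \<omega> where "\<omega> \<in> \<Omega>" "X \<omega>1 \<union> X \<omega>2 \<subseteq> X \<omega>"
      using assms(1) \<omega> unfolding upward_directed_def by blast
    then have "Q \<omega> \<le> Q \<omega>1" "Q \<omega> \<le> Q \<omega>2" unfolding Q_def principal_le_iff by blast+
    then show ?thesis using \<open>\<omega> \<in> \<Omega>\<close> by (intro bexI[of _ \<omega>] inf_greatest)
  qed
  then have "eventually P (INF \<omega>\<in>\<Omega>. Q \<omega>) \<longleftrightarrow> (\<exists>\<omega>\<in>\<Omega>. eventually P (Q \<omega>))"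
    by (rule eventually_INF_base[OF assms(2)])
  then show ?thesis
    unfolding tail_filter_def Q_def eventually_principal by simp blast
qed


section \<open>Subnormality of directed unions\<close>

theorem theorem5p1:
  fixes S :: "'a::chilbert_space operator"
    and \<Omega> :: "'w set"
    and H X :: "'w \<Rightarrow> 'a set"
  assumes "densely_defined_in UNIV S"
    and "\<And>\<omega>. \<omega> \<in> \<Omega> \<Longrightarrow> closed_csubspace (H \<omega>)"
    and "upward_directed \<Omega> X"
    and "\<And>\<omega>. \<omega> \<in> \<Omega> \<Longrightarrow> X \<omega> \<subseteq> D_infinity S"
    and "\<And>\<omega> n. \<omega> \<in> \<Omega> \<Longrightarrow> (S ^^ n) `` X \<omega> \<subseteq> H \<omega>"
    and "\<And>\<omega>. \<omega> \<in> \<Omega> \<Longrightarrow> dense_in (orbit_span S (X \<omega>)) (H \<omega>)"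
    and "\<And>\<omega>. \<omega> \<in> \<Omega> \<Longrightarrow>
           subnormal TYPE('k::chilbert_space) (H \<omega>) (op_restrict S (orbit_span S (X \<omega>)))"
    and "is_core (orbit_span S (\<Union>\<omega>\<in>\<Omega>. X \<omega>)) S"
  shows "subnormal TYPE(('a \<times> nat \<Rightarrow> complex) ell2) UNIV S"
proof -
  define F where "F \<omega> = orbit_span S (X \<omega>)" for \<omega>
  define F0 where "F0 = orbit_span S (\<Union>\<omega>\<in>\<Omega>. X \<omega>)"
  define T where "T \<omega> = op_restrict S (F \<omega>)" for \<omega>
  define T0 where "T0 = op_restrict S F0"
  have S: "operator_in UNIV S" and S_dense: "closure (Domain S) = UNIV"
    using assms(1) by (auto simp: densely_defined_in_def dense_in_def)
  have T: "Domain (T \<omega>) = F \<omega>" "Range (T \<omega>) \<subseteq> F \<omega>" if "\<omega> \<in> \<Omega>" for \<omega>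
    unfolding T_def F_def using restriction_to_orbit[OF S assms(4)[OF that]] by simp_all
  have "(\<Union>\<omega>\<in>\<Omega>. X \<omega>) \<subseteq> D_infinity S" using assms(4) by blast
  from restriction_to_orbit[OF S this]
  have T0: "Domain T0 = F0" "Range T0 \<subseteq> F0" unfolding T0_def F0_def .
  have core: "S \<subseteq> closure T0"
    using assms(8) by (simp add: is_core_def T0_def F0_def)
  have "fst ` closure T0 \<subseteq> closure F0"
  proof (rule image_closure_subset)
    show "fst ` T0 \<subseteq> closure F0" using T0(1) closure_subset[of F0] by (auto simp: T0_def op_restrict_def)
  qed (auto intro: continuous_on_fst)
  with core have "Domain S \<subseteq> closure F0" by (auto simp: Domain_fst)
  then have dense: "closure (Domain T0) = UNIV"
    using S_dense closure_minimal[of "Domain S" "closure F0"] by (simp add: T0(1) top_unique)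

  have "\<exists>\<phi> :: 'a \<times> letter list \<Rightarrow> ('a \<times> nat \<Rightarrow> complex) ell2. dilation T0 \<phi>"
  proof (cases "\<Omega> = {}")
    case True
    \<comment> \<open>For an empty family the core is \<open>{0}\<close>, which has the zero dilation.\<close>
    then have "F0 = {0}" by (simp add: F0_def orbit_span_def)
    then have "dilation T0 (\<lambda>_. 0)" using T0(1) by (auto simp: dilation_def)
    then show ?thesis by blast
  next
    case nonempty: False
    note ev = eventually_tail_filter[OF assms(3) nonempty]
    have "\<exists>\<psi> :: 'a \<times> letter list \<Rightarrow> 'k. dilation (T \<omega>) \<psi>" if \<omega>: "\<omega> \<in> \<Omega>" for \<omega>
    proof -
      obtain K :: "'k set" and V N where KVN: "closed_csubspace K" "isometric_embedding (H \<omega>) K V"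
        "normal_in K N" "\<forall>(x, y)\<in>T \<omega>. (V x, V y) \<in> N"
        using assms(7)[OF \<omega>] unfolding subnormal_def T_def F_def by blast
      have sub: "csubspace (H \<omega>)" using assms(2)[OF \<omega>] by (simp add: closed_csubspace_def)
      have "F \<omega> \<subseteq> H \<omega>" using assms(6)[OF \<omega>] by (simp add: dense_in_def F_def)
      then have T': "Domain (T \<omega>) \<subseteq> H \<omega>" "Range (T \<omega>) \<subseteq> Domain (T \<omega>)" using T[OF \<omega>] by simp_all
      have ext: "(V x, V y) \<in> N" if "(x, y) \<in> T \<omega>" for x y using KVN(4) that by blast
      obtain \<psi> :: "'a \<times> letter list \<Rightarrow> 'k" where "dilation (T \<omega>) \<psi>"
        by (rule normal_extension_imp_dilation[OF KVN(1,3) sub T' KVN(2) ext])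
      then show ?thesis by blast
    qed
    then obtain \<psi> :: "'w \<Rightarrow> 'a \<times> letter list \<Rightarrow> 'k" where \<psi>: "\<And>\<omega>. \<omega> \<in> \<Omega> \<Longrightarrow> dilation (T \<omega>) (\<psi> \<omega>)"
      by metis
    \<comment> \<open>Words are countable, so the index set of the dilation embeds into the index type of the target.\<close>
    define \<iota> :: "'a \<times> letter list \<Rightarrow> 'a \<times> nat \<Rightarrow> complex" where
      "\<iota> e = (\<lambda>p. if p = (fst e, to_nat (snd e)) then 1 else 0)" for e
    have "inj \<iota>"
    proof (rule injI)
      fix d e assume "\<iota> d = \<iota> e"
      from fun_cong[OF this, of "(fst d, to_nat (snd d))"] show "d = e"
        by (auto simp: \<iota>_def prod_eq_iff split: if_splits)
    qed
    have "tail_filter \<Omega> X \<noteq> bot"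
      unfolding trivial_limit_def ev by blast
    moreover have "\<forall>\<^sub>F \<omega> in tail_filter \<Omega> X. dilation (T \<omega>) (\<psi> \<omega>)"
      unfolding ev using \<psi> nonempty by blast
    moreover have "\<forall>\<^sub>F \<omega> in tail_filter \<Omega> X. T \<omega> \<subseteq> T0"
    proof -
      have "T \<omega> \<subseteq> T0" if "\<omega> \<in> \<Omega>" for \<omega>
        using orbit_span_mono[of "X \<omega>" "\<Union>\<omega>\<in>\<Omega>. X \<omega>" S] that
        unfolding T_def T0_def op_restrict_def F_def F0_def by blast
      with nonempty show ?thesis unfolding ev by blast
    qed
    moreover have "\<forall>\<^sub>F \<omega> in tail_filter \<Omega> X. p \<in> T \<omega>" if p: "p \<in> T0" for p
    proof -
      obtain f g where fg: "p = (f, g)" by (cases p)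
      have "f \<in> F0" "(f, g) \<in> S" using p by (auto simp: fg T0_def op_restrict_def)
      obtain \<omega> where \<omega>: "\<omega> \<in> \<Omega>" "f \<in> orbit_span S (X \<omega>)"
        using \<open>f \<in> F0\<close> unfolding F0_def
        by (rule orbit_span_directed_union[OF assms(3) nonempty])
      have "p \<in> T \<omega>'" if "X \<omega> \<subseteq> X \<omega>'" for \<omega>'
        using \<open>(f, g) \<in> S\<close> \<omega>(2) orbit_span_mono[OF that, of S] by (auto simp: fg T_def op_restrict_def F_def)
      with \<omega>(1) show ?thesis unfolding ev by blast
    qed
    ultimately obtain \<phi> :: "'a \<times> letter list \<Rightarrow> ('a \<times> nat \<Rightarrow> complex) ell2" where "dilation T0 \<phi>"
      using \<open>inj \<iota>\<close> by (rule dilation_limit)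
    then show ?thesis by blast
  qed
  then obtain \<phi> :: "'a \<times> letter list \<Rightarrow> ('a \<times> nat \<Rightarrow> complex) ell2" where \<phi>: "dilation T0 \<phi>" by blast
  have inv: "Range T0 \<subseteq> Domain T0" using T0 by simp
  obtain K :: "('a \<times> nat \<Rightarrow> complex) ell2 set" and V N where KVN: "closed_csubspace K"
    "isometric_embedding UNIV K V" "bounded_clinear V" "normal_in K N" "\<And>x y. (x, y) \<in> T0 \<Longrightarrow> (V x, V y) \<in> N"
    by (rule dilation_imp_normal_extension[OF \<phi> inv dense]) (rule that, assumption+)
  have "closed N" using KVN(4) by (simp add: normal_in_def)
  have "(\<lambda>p. (V (fst p), V (snd p))) ` closure T0 \<subseteq> N" (is "?W ` _ \<subseteq> _")
  proof (rule image_closure_subset[OF _ \<open>closed N\<close>])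
    have V: "continuous_on A (\<lambda>p. V (g p))" if "continuous_on A g" for A :: "('a \<times> 'a) set" and g
      using bounded_clinear_continuous[OF KVN(3), of UNIV] that
      by (rule continuous_on_compose2) simp
    show "continuous_on (closure T0) ?W"
      by (intro continuous_on_Pair V continuous_on_fst continuous_on_snd continuous_on_id)
  qed (use KVN(5) in auto)
  then have "?W p \<in> N" if "p \<in> S" for p
    by (rule subsetD) (use core that in \<open>intro imageI, rule subsetD\<close>)
  then have "\<forall>(x, y)\<in>S. (V x, V y) \<in> N" by auto
  then show ?thesis
    unfolding subnormal_def
    by (intro conjI exI[of _ K] exI[of _ V] exI[of _ N] assms(1) KVN(1,2,4))
qed

end
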